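(* Let $\mathscr{M}$ be an $n$-dimensional smooth manifold and let $X(\cdot,t):\mathscr{M}\to\mathbb{R}^{n+1}$ be a family of smooth hypersurface immersions satisfying $$\frac{\partial^2}{\partial t^2}X(x,t)=H(x,t)\vec n(x,t)+c_1(t)X(x,t),$$ where $c_1(t)$ is a bounded continuous function. Then $$\frac{\partial^2g_{ij}}{\partial t^2}=-2Hh_{ij}+2c_1(t)g_{ij}+2\left(\frac{\partial^2X}{\partial t\partial x^i},\frac{\partial^2X}{\partial t\partial x^j}\right),$$ $$\frac{\partial^2\vec n}{\partial t^2}=-g^{ij}\frac{\partial H}{\partial x^i}\frac{\partial X}{\partial x^j}+g^{ij}\left(\vec n,\frac{\partial^2X}{\partial t\partial x^i}\right)\left[2g^{kl}\left(\frac{\partial X}{\partial x^j},\frac{\partial^2X}{\partial t\partial x^l}\right)\frac{\partial X}{\partial x^k}+g^{kl}\left(\frac{\partial X}{\partial x^l},\frac{\partial^2X}{\partial t\partial x^j}\right)\frac{\partial X}{\partial x^k}-\frac{\partial^2X}{\partial t\partial x^j}\right],$$ and $$\frac{\partial^2h_{ij}}{\partial t^2}=\triangle h_{ij}-2Hh_{il}h_{mj}g^{lm}+|A|^2h_{ij}+g^{kl}h_{ij}\left(\vec n,\frac{\partial^2X}{\partial t\partial x^k}\right)\left(\vec n,\frac{\partial^2X}{\partial t\partial x^l}\right)-2\frac{\partial\Gamma_{ij}^k}{\partial t}\left(\vec n,\frac{\partial^2X}{\partial t\partial x^k}\right)+c_1(t)h_{ij}.$$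
   Context: $(\cdot,\cdot)$ is the Euclidean inner product of $\mathbb{R}^{n+1}$; $\{x^i\}$ are local coordinates on $\mathscr{M}$ (independent of $t$), and repeated indices are summed. $\vec n$ is the unit inward normal of $X(\cdot,t)$, $g_{ij}=\left(\frac{\partial X}{\partial x^i},\frac{\partial X}{\partial x^j}\right)$ the induced metric with inverse $(g^{ij})$, $h_{ij}=\left(\vec n,\frac{\partial^2X}{\partial x^i\partial x^j}\right)$ the second fundamental form, $H=g^{ij}h_{ij}$ the mean curvature, $|A|^2=g^{ij}g^{kl}h_{ik}h_{jl}$, $\Gamma_{ij}^k=g^{kl}\left(\frac{\partial^2X}{\partial x^i\partial x^j},\frac{\partial X}{\partial x^l}\right)$ the Christoffel symbols, and $\nabla$, $\triangle=g^{ij}\nabla_i\nabla_j$ the Levi-Civita connection and Laplacian of the induced metric (acting on tensors). *)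

theory Defs
  imports "HOL-Analysis.Analysis"
begin

text \<open>\<open>C\<^sup>k\<close> on an open set: all iterated directional derivatives up to order \<open>k\<close> exist
  (as Frechet derivatives in the given directions) and are continuous.\<close>

primrec Ck_on :: "nat \<Rightarrow> 'v::euclidean_space set \<Rightarrow> ('v \<Rightarrow> 'e::euclidean_space) \<Rightarrow> bool" where
  "Ck_on 0 S f \<longleftrightarrow> continuous_on S f"
| "Ck_on (Suc k) S f \<longleftrightarrow>
     (\<forall>u\<in>S. f differentiable (at u)) \<and>
     (\<forall>v. Ck_on k S (\<lambda>u. frechet_derivative f (at u) v))"

definition smooth_on :: "'v::euclidean_space set \<Rightarrow> ('v \<Rightarrow> 'e::euclidean_space) \<Rightarrow> bool" where
  "smooth_on S f \<longleftrightarrow> (\<forall>k. Ck_on k S f)"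

text \<open>A chart \<open>(U, \<phi>)\<close> consists of its domain and its coordinate map; only the values of \<open>\<phi>\<close>
  on \<open>U\<close> matter. \<open>loc (U, \<phi>) f\<close> is the coordinate expression \<open>f \<circ> \<phi>\<^sup>-\<^sup>1\<close>, meaningful on \<open>\<phi> ` U\<close>.\<close>

type_synonym ('a, 'n) chart = "'a set \<times> ('a \<Rightarrow> real ^ 'n)"

definition loc :: "('a, 'n) chart \<Rightarrow> ('a \<Rightarrow> 'b) \<Rightarrow> real ^ 'n \<Rightarrow> 'b" where
  "loc c f = (\<lambda>u. f (inv_into (fst c) (snd c) u))"

text \<open>The atlas is not required to be maximal; a statement about all charts of an arbitrary atlas
  may be applied to the maximal one, and so covers all local coordinate systems.\<close>

definition smooth_atlas :: "'a topology \<Rightarrow> ('a, 'n::finite) chart set \<Rightarrow> bool" where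
  "smooth_atlas M A \<longleftrightarrow>
     (\<forall>(U, \<phi>)\<in>A. openin M U \<and> open (\<phi> ` U) \<and>
        homeomorphic_map (subtopology M U) (top_of_set (\<phi> ` U)) \<phi>) \<and>
     (\<Union>(U, \<phi>)\<in>A. U) = topspace M \<and>
     (\<forall>(U, \<phi>)\<in>A. \<forall>(V, \<psi>)\<in>A. smooth_on (\<phi> ` (U \<inter> V)) (loc (U, \<phi>) \<psi>))"

definition smooth_manifold :: "'a topology \<Rightarrow> ('a, 'n::finite) chart set \<Rightarrow> bool" where
  "smooth_manifold M A \<longleftrightarrow> Hausdorff_space M \<and> second_countable M \<and> smooth_atlas M A"

definition smooth_immersion ::
    "('a, 'n::finite) chart set \<Rightarrow> ('a \<Rightarrow> 'e::euclidean_space) \<Rightarrow> bool" where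
  "smooth_immersion A f \<longleftrightarrow>
     (\<forall>(U, \<phi>)\<in>A. smooth_on (\<phi> ` U) (loc (U, \<phi>) f) \<and>
        (\<forall>u\<in>\<phi> ` U. inj (frechet_derivative (loc (U, \<phi>) f) (at u))))"

text \<open>Time ranges over a nondegenerate interval \<open>I\<close>; at an endpoint belonging to \<open>I\<close>
  (such as \<open>0\<close> in \<open>[0, T)\<close>) time derivatives are one-sided.\<close>

definition dt :: "real set \<Rightarrow> (real \<Rightarrow> 'e::real_normed_vector) \<Rightarrow> real \<Rightarrow> 'e" where
  "dt I f t = vector_derivative f (at t within I)"

text \<open>The second derivative at \<open>t\<close> exists (so \<open>f\<close> is differentiable on all of \<open>I\<close>) and equals \<open>D\<close>.\<close>

definition has_second_derivative ::
    "real set \<Rightarrow> (real \<Rightarrow> 'e::real_normed_vector) \<Rightarrow> 'e \<Rightarrow> real \<Rightarrow> bool" where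
  "has_second_derivative I f D t \<longleftrightarrow>
     (\<exists>f'. (\<forall>s\<in>I. (f has_vector_derivative f' s) (at s within I)) \<and>
           (f' has_vector_derivative D) (at t within I))"

text \<open>Smoothness in the space variable, jointly continuous in time: all iterated space derivatives exist and are
  jointly continuous in \<open>(t, u)\<close>.\<close>

primrec space_Ck :: "nat \<Rightarrow> real set \<Rightarrow> 'v::euclidean_space set \<Rightarrow>
    (real \<Rightarrow> 'v \<Rightarrow> 'e::euclidean_space) \<Rightarrow> bool" where
  "space_Ck 0 I W F \<longleftrightarrow> continuous_on (I \<times> W) (\<lambda>(t, u). F t u)"
| "space_Ck (Suc k) I W F \<longleftrightarrow>
     (\<forall>t\<in>I. \<forall>u\<in>W. F t differentiable (at u)) \<and>
     (\<forall>v. space_Ck k I W (\<lambda>t u. frechet_derivative (F t) (at u) v))"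

definition space_smooth :: "real set \<Rightarrow> 'v::euclidean_space set \<Rightarrow>
    (real \<Rightarrow> 'v \<Rightarrow> 'e::euclidean_space) \<Rightarrow> bool" where
  "space_smooth I W F \<longleftrightarrow> (\<forall>k. space_Ck k I W F)"

text \<open>Regularity of a family of smooth maps evolving by a second order equation: \<open>F\<close>,
  \<open>\<partial>F/\<partial>t\<close> and \<open>\<partial>\<^sup>2F/\<partial>t\<^sup>2\<close> exist and are smooth in space. Smoothness in time
  is not required, since the coefficient \<open>c\<^sub>1\<close> of the flow is merely continuous; jointly smooth
  families are included.\<close>

definition C2_family_on :: "real set \<Rightarrow> 'v::euclidean_space set \<Rightarrow>
    (real \<Rightarrow> 'v \<Rightarrow> 'e::euclidean_space) \<Rightarrow> bool" where
  "C2_family_on I W F \<longleftrightarrow>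
     (\<exists>F' F''.
        (\<forall>t\<in>I. \<forall>u\<in>W. ((\<lambda>s. F s u) has_vector_derivative F' t u) (at t within I)) \<and>
        (\<forall>t\<in>I. \<forall>u\<in>W. ((\<lambda>s. F' s u) has_vector_derivative F'' t u) (at t within I)) \<and>
        space_smooth I W F \<and> space_smooth I W F' \<and> space_smooth I W F'')"

definition C2_family :: "('a, 'n::finite) chart set \<Rightarrow> real set \<Rightarrow>
    (real \<Rightarrow> 'a \<Rightarrow> 'e::euclidean_space) \<Rightarrow> bool" where
  "C2_family A I X \<longleftrightarrow> (\<forall>(U, \<phi>)\<in>A. C2_family_on I (\<phi> ` U) (\<lambda>t. loc (U, \<phi>) (X t)))"

text \<open>Below, \<open>f\<close> is an immersion and \<open>N\<close> a unit normal field along it, both in local coordinates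
  \<open>u\<close>; indices are elements of the finite type \<open>'n\<close>.\<close>

definition pd :: "'n::finite \<Rightarrow> (real ^ 'n \<Rightarrow> 'e::real_normed_vector) \<Rightarrow> real ^ 'n \<Rightarrow> 'e" where
  "pd i f u = frechet_derivative f (at u) (axis i 1)"

definition ind_metric :: "(real ^ 'n::finite \<Rightarrow> 'e::euclidean_space) \<Rightarrow> real ^ 'n \<Rightarrow> real ^ 'n ^ 'n" where
  "ind_metric f u = (\<chi> i j. pd i f u \<bullet> pd j f u)"

definition metric_inv ::
    "(real ^ 'n::finite \<Rightarrow> 'e::euclidean_space) \<Rightarrow> real ^ 'n \<Rightarrow> real ^ 'n ^ 'n" where
  "metric_inv f u = matrix_inv (ind_metric f u)"

definition second_ff :: "(real ^ 'n::finite \<Rightarrow> 'e::euclidean_space) \<Rightarrow> (real ^ 'n \<Rightarrow> 'e) \<Rightarrow>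
    'n \<Rightarrow> 'n \<Rightarrow> real ^ 'n \<Rightarrow> real" where
  "second_ff f N i j u = N u \<bullet> pd i (pd j f) u"

definition mean_curv :: "(real ^ 'n::finite \<Rightarrow> 'e::euclidean_space) \<Rightarrow> (real ^ 'n \<Rightarrow> 'e) \<Rightarrow>
    real ^ 'n \<Rightarrow> real" where
  "mean_curv f N u = (\<Sum>i\<in>UNIV. \<Sum>j\<in>UNIV. metric_inv f u $ i $ j * second_ff f N i j u)"

definition normsq_A :: "(real ^ 'n::finite \<Rightarrow> 'e::euclidean_space) \<Rightarrow> (real ^ 'n \<Rightarrow> 'e) \<Rightarrow>
    real ^ 'n \<Rightarrow> real" where
  "normsq_A f N u = (\<Sum>i\<in>UNIV. \<Sum>j\<in>UNIV. \<Sum>k\<in>UNIV. \<Sum>l\<in>UNIV.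
     metric_inv f u $ i $ j * metric_inv f u $ k $ l * second_ff f N i k u * second_ff f N j l u)"

text \<open>\<open>christoffel f k i j\<close> is the symbol with upper index \<open>k\<close> and lower indices \<open>i\<close>, \<open>j\<close>.\<close>

definition christoffel :: "(real ^ 'n::finite \<Rightarrow> 'e::euclidean_space) \<Rightarrow>
    'n \<Rightarrow> 'n \<Rightarrow> 'n \<Rightarrow> real ^ 'n \<Rightarrow> real" where
  "christoffel f k i j u = (\<Sum>l\<in>UNIV. metric_inv f u $ k $ l * (pd i (pd j f) u \<bullet> pd l f u))"

text \<open>A covariant tensor of rank \<open>r\<close> is given by its components, indexed by lists of length \<open>r\<close>.
  The components of the covariant derivative are \<open>\<nabla>\<^sub>k T\<close> at \<open>(j\<^sub>1, \<dots>, j\<^sub>r)\<close>, with the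
  differentiation index \<open>k\<close> put first; hence
  \<open>cov_deriv f (cov_deriv f T) (k # l # js)\<close> is \<open>\<nabla>\<^sub>k \<nabla>\<^sub>l T\<close> at \<open>js\<close>.\<close>

primrec cov_deriv :: "(real ^ 'n::finite \<Rightarrow> 'e::euclidean_space) \<Rightarrow>
    ('n list \<Rightarrow> real ^ 'n \<Rightarrow> real) \<Rightarrow> 'n list \<Rightarrow> real ^ 'n \<Rightarrow> real" where
  "cov_deriv f T [] = (\<lambda>u. 0)"
| "cov_deriv f T (k # js) = (\<lambda>u. pd k (T js) u -
     (\<Sum>p<length js. \<Sum>m\<in>UNIV. christoffel f m k (js ! p) u * T (js[p := m]) u))"

definition laplacian :: "(real ^ 'n::finite \<Rightarrow> 'e::euclidean_space) \<Rightarrow>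
    ('n list \<Rightarrow> real ^ 'n \<Rightarrow> real) \<Rightarrow> 'n list \<Rightarrow> real ^ 'n \<Rightarrow> real" where
  "laplacian f T js u = (\<Sum>k\<in>UNIV. \<Sum>l\<in>UNIV.
     metric_inv f u $ k $ l * cov_deriv f (cov_deriv f T) (k # l # js) u)"

text \<open>For a general immersion "inward" is a choice of one of the two unit normals that is continuous
  on space-time; \<open>\<nu>\<close> is any such choice (for instance the inward normal whenever the immersed
  hypersurfaces bound regions). Note that \<open>H \<nu>\<close> does not depend on the choice.\<close>

definition unit_normal_field :: "'a topology \<Rightarrow> ('a, 'n::finite) chart set \<Rightarrow> real set \<Rightarrow>
    (real \<Rightarrow> 'a \<Rightarrow> 'e::euclidean_space) \<Rightarrow> (real \<Rightarrow> 'a \<Rightarrow> 'e) \<Rightarrow> bool" where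
  "unit_normal_field M A I X \<nu> \<longleftrightarrow>
     continuous_map (prod_topology (top_of_set I) M) euclidean (\<lambda>(t, x). \<nu> t x) \<and>
     (\<forall>t\<in>I. \<forall>x\<in>topspace M. norm (\<nu> t x) = 1) \<and>
     (\<forall>(U, \<phi>)\<in>A. \<forall>t\<in>I. \<forall>x\<in>U. \<forall>i. \<nu> t x \<bullet> pd i (loc (U, \<phi>) (X t)) (\<phi> x) = 0)"

text \<open>The equation \<open>\<partial>\<^sup>2X/\<partial>t\<^sup>2 = H \<nu> + c\<^sub>1 X\<close>, with \<open>H\<close> computed in any of the charts.\<close>

definition hyperbolic_mcf :: "('a, 'n::finite) chart set \<Rightarrow> real set \<Rightarrow> (real \<Rightarrow> real) \<Rightarrow>
    (real \<Rightarrow> 'a \<Rightarrow> 'e::euclidean_space) \<Rightarrow> (real \<Rightarrow> 'a \<Rightarrow> 'e) \<Rightarrow> bool" where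
  "hyperbolic_mcf A I c1 X \<nu> \<longleftrightarrow>
     (\<forall>(U, \<phi>)\<in>A. \<forall>t\<in>I. \<forall>x\<in>U.
        has_second_derivative I (\<lambda>s. X s x)
          (mean_curv (loc (U, \<phi>) (X t)) (loc (U, \<phi>) (\<nu> t)) (\<phi> x) *\<^sub>R \<nu> t x + c1 t *\<^sub>R X t x) t)"

end

theory Submission
  imports Defs
begin

text \<open>
  Write \<open>X\<^sub>i\<close>, \<open>X\<^sub>i\<^sub>j\<close> for coordinate derivatives and \<open>X\<^sup>k = g\<^sup>k\<^sup>l X\<^sub>l\<close>, so that
  \<open>\<Gamma>\<^sup>k\<^sub>i\<^sub>j = (X\<^sub>i\<^sub>j, X\<^sup>k)\<close>. The time derivatives of \<open>N\<close> follow by differentiating \<open>(N, N) = 1\<close> and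
  \<open>(N, X\<^sub>i) = 0\<close> twice, those of \<open>h\<^sub>i\<^sub>j = (N, X\<^sub>i\<^sub>j)\<close> by combining this with the time derivative of the Gauss
  formula; the flow equation enters through \<open>(N, \<partial>\<^sub>t\<^sup>2 X\<^sub>i\<^sub>j)\<close>, which produces
  \<open>\<nabla>\<^sub>i\<nabla>\<^sub>j H\<close>, and Simons' identity converts that Hessian into the Laplacian of \<open>h\<close>.
  Since \<open>\<Gamma>\<^sup>m\<^sub>l\<^sub>i h\<^sub>m\<^sub>j = - (X\<^sub>l\<^sub>i, N\<^sub>j)\<close>, covariant derivatives of \<open>h\<close> can be written with ambient
  derivatives only, and curvature tensors are never needed.

  The normal is only assumed continuous. Its differentiability comes from writing it locally as the
  normalized normal part of a fixed vector; Weingarten's formula and the formula for \<open>\<partial>\<^sub>t N\<close> then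
  give the higher derivatives.
\<close>

subsection \<open>Frames of a hyperplane with unit normal\<close>

definition gram :: "('n::finite \<Rightarrow> 'e::real_inner) \<Rightarrow> real ^ 'n ^ 'n" where
  "gram E = (\<chi> i j. E i \<bullet> E j)"

definition dual_frame :: "('n::finite \<Rightarrow> 'e::real_inner) \<Rightarrow> 'n \<Rightarrow> 'e" where
  "dual_frame E k = (\<Sum>l\<in>UNIV. (matrix_inv (gram E) $ k $ l) *\<^sub>R E l)"

text \<open>Codimension one is built in: with it, independence of \<open>E\<close> and a unit
  \<open>N\<close> orthogonal to \<open>E\<close> make \<open>E\<close> together with
  \<open>N\<close> a basis of the ambient space, so every vector can be expanded.\<close>

definition normal_frame :: "('n::finite \<Rightarrow> 'e::euclidean_space) \<Rightarrow> 'e \<Rightarrow> bool" where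
  "normal_frame E N \<longleftrightarrow> DIM('e) = CARD('n) + 1 \<and> norm N = 1 \<and> (\<forall>i. N \<bullet> E i = 0) \<and>
     (\<forall>c. (\<Sum>i\<in>UNIV. c i *\<^sub>R E i) = 0 \<longrightarrow> (\<forall>i. c i = 0))"

lemma gram_nth [simp]: "gram E $ i $ j = E i \<bullet> E j"
  by (simp add: gram_def)

lemma matrix_inv_inverse:
  assumes "invertible A"
  shows "A ** matrix_inv A = mat 1" "matrix_inv A ** A = mat 1"
  using assms unfolding invertible_def matrix_inv_def by (metis (mono_tags, lifting) someI_ex)+

text \<open>If \<open>c\<close> is in the kernel of the Gram matrix, the quadratic form at
  \<open>c\<close>, which is the squared length of the combination of the \<open>E i\<close>,
  vanishes; independence then forces \<open>c = 0\<close>.\<close>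

lemma invertible_gram:
  fixes E :: "'n::finite \<Rightarrow> 'e::real_inner"
  assumes indep: "\<And>c. (\<Sum>i\<in>UNIV. c i *\<^sub>R E i) = 0 \<Longrightarrow> \<forall>i. c i = 0"
  shows "invertible (gram E)"
proof -
  have "c = 0" if c: "gram E *v c = 0" for c
  proof -
    let ?s = "\<Sum>i\<in>UNIV. (c $ i) *\<^sub>R E i"
    have "?s \<bullet> ?s = (\<Sum>i\<in>UNIV. c $ i * (gram E *v c) $ i)"
      by (simp add: inner_sum_left inner_sum_right matrix_vector_mult_def sum_distrib_left
          inner_commute ac_simps)
    then have "?s = 0" by (simp add: c)
    then show "c = 0" using indep[of "\<lambda>i. c $ i"] by (simp add: vec_eq_iff)
  qed
  then show ?thesis
    unfolding invertible_left_inverse matrix_left_invertible_ker by blast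
qed

lemma gram_inv_sym: "invertible (gram E) \<Longrightarrow> matrix_inv (gram E) $ i $ j = matrix_inv (gram E) $ j $ i"
proof -
  let ?G = "gram E" and ?I = "matrix_inv (gram E)"
  assume inv: "invertible (gram E)"
  have t: "transpose ?G = ?G" by (simp add: transpose_def vec_eq_iff inner_commute)
  have "transpose ?I ** ?G = mat 1"
    by (metis inv matrix_inv_inverse(1) matrix_transpose_mul t transpose_mat)
  then have "transpose ?I ** (?G ** ?I) = ?I"
    by (simp add: matrix_mul_assoc)
  then have "transpose ?I = ?I"
    by (simp add: matrix_inv_inverse(1)[OF inv])
  then have "transpose ?I $ i $ j = ?I $ i $ j" by simp
  then show ?thesis by (simp add: transpose_def)
qed

lemma inner_dual_frame:
  assumes "invertible (gram E)"
  shows "E i \<bullet> dual_frame E k = (if i = k then 1 else 0)"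
proof -
  have "(matrix_inv (gram E) ** gram E) $ k $ i = (if i = k then 1 else 0)"
    by (simp add: matrix_inv_inverse[OF assms] mat_def)
  then show ?thesis
    by (simp add: dual_frame_def inner_sum_right matrix_matrix_mult_def inner_commute)
qed

text \<open>The inverse metric is itself the Gram matrix of the dual frame. This lets
  \<open>pd_gi\<close> differentiate the inverse metric by the product rule.\<close>

lemma inner_dual_dual:
  assumes "invertible (gram E)"
  shows "dual_frame E k \<bullet> dual_frame E l = matrix_inv (gram E) $ k $ l"
proof -
  have "dual_frame E k \<bullet> dual_frame E l = (\<Sum>i\<in>UNIV. matrix_inv (gram E) $ k $ i * (if i = l then 1 else 0))"
    by (subst dual_frame_def) (simp only: inner_sum_left inner_scaleR_left inner_dual_frame[OF assms])
  then show ?thesis by (simp add: if_distrib cong: if_cong)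
qed

lemma normal_frame_invertible: "normal_frame E N \<Longrightarrow> invertible (gram E)"
  by (rule invertible_gram) (auto simp: normal_frame_def)

lemma normal_frame_inner:
  assumes "normal_frame E N"
  shows "N \<bullet> N = 1" "N \<bullet> E i = 0" "E i \<bullet> N = 0" "N \<bullet> dual_frame E i = 0" "dual_frame E i \<bullet> N = 0"
  using assms by (auto simp: normal_frame_def dual_frame_def dot_square_norm inner_sum_right inner_sum_left inner_commute)

text \<open>Combining coefficients \<open>(c, r)\<close> linearly is injective between spaces of
  equal dimension, hence surjective.\<close>

lemma normal_frame_spans:
  fixes E :: "'n::finite \<Rightarrow> 'e::euclidean_space"
  assumes F: "normal_frame E N"
  obtains c r where "v = (\<Sum>i\<in>UNIV. c i *\<^sub>R E i) + r *\<^sub>R N"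
proof -
  define L where "L = (\<lambda>(c::real^'n, r::real). (\<Sum>i\<in>UNIV. (c $ i) *\<^sub>R E i) + r *\<^sub>R N)"
  have lin: "linear L"
    by (rule linearI)
      (auto simp: L_def algebra_simps sum.distrib scaleR_sum_right)
  have "z = 0" if z: "L z = 0" for z
  proof -
    obtain c r where zz: "z = (c, r)" by fastforce
    have "L z \<bullet> N = r"
      using normal_frame_inner[OF F] by (simp add: L_def zz inner_add_left inner_sum_left)
    then have r: "r = 0" using z by simp
    then have "(\<Sum>i\<in>UNIV. (c $ i) *\<^sub>R E i) = 0" using z by (simp add: L_def zz)
    then have "c = 0" using F unfolding normal_frame_def by (simp add: vec_eq_iff)
    then show ?thesis using r zz by (simp add: zero_prod_def)
  qed
  then have "inj L" using lin by (simp add: linear_injective_0)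
  moreover have "DIM((real^'n) \<times> real) = DIM('e)" using F by (simp add: normal_frame_def)
  ultimately have "surj L" 
    using lin by (intro linear_injective_imp_surjective) simp_all
  then obtain c r where "v = L (c, r)" by (metis surj_pair surjE)
  then show thesis using that by (auto simp: L_def)
qed

text \<open>Applied to a second derivative of the immersion this is the Gauss formula: the
  coefficients are the Christoffel symbols and the second fundamental form.\<close>

lemma normal_frame_expand:
  fixes E :: "'n::finite \<Rightarrow> 'e::euclidean_space"
  assumes F: "normal_frame E N"
  shows "v = (\<Sum>k\<in>UNIV. (v \<bullet> dual_frame E k) *\<^sub>R E k) + (v \<bullet> N) *\<^sub>R N"
proof -
  obtain c r where v: "v = (\<Sum>i\<in>UNIV. c i *\<^sub>R E i) + r *\<^sub>R N"
    using normal_frame_spans[OF F] .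
  have "v \<bullet> N = r"
    using normal_frame_inner[OF F] by (simp add: v inner_add_left inner_sum_left)
  moreover have "v \<bullet> dual_frame E k = c k" for k
    by (simp add: v inner_add_left inner_sum_left normal_frame_inner[OF F]
        inner_dual_frame[OF normal_frame_invertible[OF F]] if_distrib cong: if_cong)
  ultimately show ?thesis using v by simp
qed

lemma normal_frame_inner_expand:
  fixes E :: "'n::finite \<Rightarrow> 'e::euclidean_space"
  assumes F: "normal_frame E N"
  shows "v \<bullet> w = (\<Sum>k\<in>UNIV. (v \<bullet> dual_frame E k) * (E k \<bullet> w)) + (v \<bullet> N) * (N \<bullet> w)"
proof -
  have "v \<bullet> w = ((\<Sum>k\<in>UNIV. (v \<bullet> dual_frame E k) *\<^sub>R E k) + (v \<bullet> N) *\<^sub>R N) \<bullet> w"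
    using normal_frame_expand[OF F, of v] by simp
  then show ?thesis by (simp add: inner_add_left inner_sum_left)
qed

text \<open>The companion expansion for vectors known through their products with the frame itself,
  such as the space and time derivatives of the normal. Testing against an arbitrary
  \<open>w\<close> reduces it to the previous expansion.\<close>

lemma normal_frame_expand_dual:
  fixes E :: "'n::finite \<Rightarrow> 'e::euclidean_space"
  assumes F: "normal_frame E N"
  shows "v = (\<Sum>k\<in>UNIV. (v \<bullet> E k) *\<^sub>R dual_frame E k) + (v \<bullet> N) *\<^sub>R N"
proof -
  have "v \<bullet> w = ((\<Sum>k\<in>UNIV. (v \<bullet> E k) *\<^sub>R dual_frame E k) + (v \<bullet> N) *\<^sub>R N) \<bullet> w" for w
    using normal_frame_inner_expand[OF F, of w v]
    by (simp add: inner_add_left inner_sum_left) (simp add: inner_commute mult.commute)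
  then show ?thesis using vector_eq_rdot by blast
qed

lemma normal_frame_eqI:
  fixes E :: "'n::finite \<Rightarrow> 'e::euclidean_space"
  assumes F: "normal_frame E N" and "\<And>k. v \<bullet> E k = w \<bullet> E k" "v \<bullet> N = w \<bullet> N"
  shows "v = w"
  using normal_frame_expand_dual[OF F, of v] normal_frame_expand_dual[OF F, of w] assms(2,3) by simp

subsection \<open>Differentiability of the dual frame and of the normal\<close>

lemma differentiable_prod:
  fixes f :: "'i \<Rightarrow> 'a::real_normed_vector \<Rightarrow> 'b::real_normed_field"
  assumes "\<And>i. i \<in> J \<Longrightarrow> f i differentiable (at x within S)"
  shows "(\<lambda>y. \<Prod>i\<in>J. f i y) differentiable (at x within S)"
proof -
  from assms have "\<forall>i\<in>J. \<exists>f'. (f i has_derivative f') (at x within S)"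
    by (simp add: differentiable_def)
  then obtain f' where "\<And>i. i \<in> J \<Longrightarrow> (f i has_derivative f' i) (at x within S)" by metis
  from has_derivative_prod[OF this] show ?thesis by (rule differentiableI)
qed

lemma differentiable_det:
  fixes B :: "'a::real_normed_vector \<Rightarrow> real ^ 'n ^ 'n"
  assumes "\<And>i j. (\<lambda>y. B y $ i $ j) differentiable (at x within S)"
  shows "(\<lambda>y. det (B y)) differentiable (at x within S)"
  unfolding det_def
  by (intro differentiable_sum ballI differentiable_mult differentiable_const differentiable_prod assms) auto

text \<open>By Cramer's rule the entries of the inverse are quotients of determinants.\<close>

lemma differentiable_matrix_inv:
  fixes B :: "'a::real_normed_vector \<Rightarrow> real ^ 'n ^ 'n"
  assumes B: "\<And>i j. (\<lambda>y. B y $ i $ j) differentiable (at x within S)"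
    and inv: "\<And>y. y \<in> S \<Longrightarrow> invertible (B y)" and x: "x \<in> S"
  shows "(\<lambda>y. matrix_inv (B y) $ k $ l) differentiable (at x within S)"
proof -
  \<comment> \<open>\<open>B y\<close> with column \<open>k\<close> replaced by the
    \<open>l\<close>-th unit vector, the numerator matrix when column \<open>l\<close> of the
    inverse is found by solving a linear system.\<close>
  define C where "C = (\<lambda>y. \<chi> i j. if j = k then axis l 1 $ i else B y $ i $ j)"
  have eq: "matrix_inv (B y) $ k $ l = det (C y) / det (B y)" if y: "y \<in> S" for y
  proof -
    have "B y *v (matrix_inv (B y) *v axis l 1) = axis l 1"
      using matrix_inv_inverse(1)[OF inv[OF y]] by (simp add: matrix_vector_mul_assoc)
    moreover have "det (B y) \<noteq> 0" using inv[OF y] by (simp add: invertible_det_nz)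
    ultimately have "matrix_inv (B y) *v axis l 1
        = (\<chi> k. det (\<chi> i j. if j = k then axis l 1 $ i else B y $ i $ j) / det (B y))"
      by (simp add: cramer)
    then have "(matrix_inv (B y) *v axis l 1) $ k = det (C y) / det (B y)"
      by (simp add: C_def)
    moreover have "(matrix_inv (B y) *v axis l 1) $ k = matrix_inv (B y) $ k $ l"
      by (simp add: matrix_vector_mul_component inner_axis)
    ultimately show ?thesis by simp
  qed
  have "(\<lambda>y. C y $ i $ j) differentiable (at x within S)" for i j
    by (cases "j = k") (auto simp: C_def B)
  then have "(\<lambda>y. det (C y) / det (B y)) differentiable (at x within S)"
    using inv[OF x] by (intro differentiable_divide differentiable_det B) (auto simp: invertible_det_nz)
  then show ?thesis
    by (rule differentiable_transform_within[OF _ zero_less_one x]) (simp add: eq)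
qed

lemma differentiable_inner:
  fixes f g :: "'a::real_normed_vector \<Rightarrow> 'e::real_inner"
  assumes "f differentiable (at x within S)" "g differentiable (at x within S)"
  shows "(\<lambda>y. f y \<bullet> g y) differentiable (at x within S)"
  using assms unfolding differentiable_def by (blast intro: has_derivative_inner)

lemma differentiable_scaleR:
  assumes "f differentiable (at x within S)" "g differentiable (at x within S)"
  shows "(\<lambda>y. f y *\<^sub>R g y) differentiable (at x within S)"
  using assms unfolding differentiable_def by (blast intro: has_derivative_scaleR)

context
  fixes E :: "'a::real_normed_vector \<Rightarrow> 'n::finite \<Rightarrow> 'e::euclidean_space" and x S
  assumes E: "\<And>i. (\<lambda>y. E y i) differentiable (at x within S)" and x: "x \<in> S"
begin

text \<open>\<open>S\<close> stays general because these facts are used twice: in space with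
  \<open>S\<close> the open patch, and in time with \<open>S\<close> an interval that may contain
  its endpoints.\<close>

lemma differentiable_gram_inv:
  assumes "\<And>y. y \<in> S \<Longrightarrow> invertible (gram (E y))"
  shows "(\<lambda>y. matrix_inv (gram (E y)) $ k $ l) differentiable (at x within S)"
  by (rule differentiable_matrix_inv) (simp_all add: differentiable_inner E x assms)

lemma differentiable_dual_frame:
  assumes "\<And>y. y \<in> S \<Longrightarrow> invertible (gram (E y))"
  shows "(\<lambda>y. dual_frame (E y) k) differentiable (at x within S)"
  unfolding dual_frame_def
  by (intro differentiable_sum ballI differentiable_scaleR differentiable_gram_inv E assms) auto

text \<open>Near \<open>x\<close> the normal is the normalized normal part of the fixed vector \<open>N x\<close>; continuity of
  \<open>N\<close> fixes its sign.\<close>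

lemma differentiable_normal:
  assumes F: "\<And>y. y \<in> S \<Longrightarrow> normal_frame (E y) (N y)"
    and N: "continuous (at x within S) N"
  shows "N differentiable (at x within S)"
proof -
  define P where "P y = N x - (\<Sum>k\<in>UNIV. (N x \<bullet> dual_frame (E y) k) *\<^sub>R E y k)" for y
  have P: "P y = (N x \<bullet> N y) *\<^sub>R N y" if "y \<in> S" for y
    using normal_frame_expand[OF F[OF that], of "N x"] unfolding P_def by (metis add_diff_cancel_left')
  have dP: "P differentiable (at x within S)" unfolding P_def
    by (intro differentiable_diff differentiable_sum ballI differentiable_scaleR differentiable_inner
        differentiable_const differentiable_dual_frame E normal_frame_invertible[OF F]) auto
  have "P x = N x" using P[OF x] normal_frame_inner(1)[OF F[OF x]] by simp
  then have nz: "P x \<noteq> 0" using normal_frame_inner(1)[OF F[OF x]] by auto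
  have "(\<lambda>y. norm (P y)) differentiable (at x within S)"
    using differentiable_chain_within[OF dP, of norm] nz
    by (simp add: o_def differentiable_at_withinI differentiable_norm_at)
  then have d: "(\<lambda>y. inverse (norm (P y)) *\<^sub>R P y) differentiable (at x within S)"
    using nz dP by (intro differentiable_scaleR differentiable_inverse) auto
  obtain d where "d > 0" and d': "\<And>y. y \<in> S \<Longrightarrow> dist y x < d \<Longrightarrow> dist (N y) (N x) < 1"
    using N unfolding continuous_within_eps_delta by (metis zero_less_one dist_commute)
  show ?thesis
  proof (rule differentiable_transform_within[OF d \<open>d > 0\<close> x])
    fix y assume y: "y \<in> S" "dist y x < d"
    have ny: "norm (N y) = 1" "norm (N x) = 1"
      using F[OF y(1)] F[OF x] by (auto simp: normal_frame_def)
    have "norm (N y - N x) < 1" using d'[OF y] by (simp add: dist_norm)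
    then have "(norm (N y - N x))\<^sup>2 < 1" by (simp add: abs_square_less_1)
    \<comment> \<open>For unit vectors the squared distance is
      \<open>2 - 2 * (N x \<bullet> N y)\<close>, so a distance below 1 forces a positive inner
      product and excludes the opposite normal.\<close>
    then have "N x \<bullet> N y > 0"
      using ny unfolding power2_norm_eq_inner norm_eq_1
      by (simp add: inner_diff_left inner_diff_right inner_commute)
    then show "inverse (norm (P y)) *\<^sub>R P y = N y"
      using ny by (simp add: P[OF y(1)])
  qed
qed

end

subsection \<open>Partial derivatives and interchange of differentiation\<close>

text \<open>The mean value inequality is applied twice to
  \<open>(G s r - G s 0) - (G t r - G t 0) - (s - t) r D' t 0\<close>, first in \<open>r\<close> and then in \<open>s\<close>.\<close>

lemma interchange_derivatives:
  fixes G G' D' :: "real \<Rightarrow> real \<Rightarrow> 'e::real_normed_vector" and D :: "real \<Rightarrow> 'e"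
  assumes J: "convex J" "t \<in> J" and e: "0 < e"
    and G: "\<And>s r. s \<in> J \<Longrightarrow> \<bar>r\<bar> < e \<Longrightarrow> ((\<lambda>s. G s r) has_vector_derivative G' s r) (at s within J)"
    and D: "\<And>s. s \<in> J \<Longrightarrow> (G s has_vector_derivative D s) (at 0)"
    and D': "\<And>s r. s \<in> J \<Longrightarrow> \<bar>r\<bar> < e \<Longrightarrow> (G' s has_vector_derivative D' s r) (at r)"
    and cont: "\<And>\<epsilon>. 0 < \<epsilon> \<Longrightarrow> \<exists>\<delta>>0. \<forall>s\<in>J. \<forall>r. \<bar>s - t\<bar> < \<delta> \<longrightarrow> \<bar>r\<bar> < \<delta> \<longrightarrow> norm (D' s r - D' t 0) \<le> \<epsilon>"
  shows "(D has_vector_derivative D' t 0) (at t within J)"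
  unfolding has_vector_derivative_def has_derivative_within_alt
proof (intro conjI allI impI)
  show "bounded_linear (\<lambda>x. x *\<^sub>R D' t 0)" by (rule bounded_linear_scaleR_left)
next
  fix \<epsilon> :: real assume \<epsilon>: "0 < \<epsilon>"
  obtain \<delta> where \<delta>: "\<delta> > 0"
    and close: "\<And>s r. s \<in> J \<Longrightarrow> \<bar>s - t\<bar> < \<delta> \<Longrightarrow> \<bar>r\<bar> < \<delta> \<Longrightarrow> norm (D' s r - D' t 0) \<le> \<epsilon>"
    using cont[OF \<epsilon>] by blast
  define \<rho> where "\<rho> = min \<delta> e"
  have \<rho>: "\<rho> > 0" using \<delta> e by (simp add: \<rho>_def)
  \<comment> \<open>\<open>K r s - K r t\<close> is exactly the double difference to be estimated.
    In its bound the factor \<open>\<bar>r\<bar>\<close> comes from the mean value inequality in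
    \<open>r\<close>, the factor \<open>\<bar>s - t\<bar>\<close> from the one in
    \<open>s\<close>.\<close>
  define K where "K r s = G s r - G s 0 - (s * r) *\<^sub>R D' t 0" for r s
  have K: "norm (K r s - K r t) \<le> \<epsilon> * \<bar>r\<bar> * \<bar>s - t\<bar>"
    if s: "s \<in> J" "\<bar>s - t\<bar> < \<delta>" and r: "\<bar>r\<bar> < \<rho>" for s r
  proof -
    define V where "V = J \<inter> ball t \<delta>"
    have V: "convex V" "s \<in> V" "t \<in> V" using J s \<delta> by (auto simp: V_def convex_Int dist_real_def)
    have G'r: "norm ((G' s' r - r *\<^sub>R D' t 0) - (G' s' 0 - 0 *\<^sub>R D' t 0)) \<le> \<epsilon> * norm (r - 0)"
      if s': "s' \<in> V" for s'
    proof (rule differentiable_bound[where S = "ball 0 \<rho>" and f' = "\<lambda>r h. h *\<^sub>R (D' s' r - D' t 0)"])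
      fix q :: real assume q: "q \<in> ball 0 \<rho>"
      have "((\<lambda>r. G' s' r - r *\<^sub>R D' t 0) has_derivative (\<lambda>h. h *\<^sub>R D' s' q - h *\<^sub>R D' t 0)) (at q within ball 0 \<rho>)"
        using D'[of s' q] s' q
        by (intro has_derivative_diff has_derivative_scaleR_left has_derivative_ident)
          (auto simp: V_def \<rho>_def has_vector_derivative_def intro: has_derivative_at_withinI)
      then show "((\<lambda>r. G' s' r - r *\<^sub>R D' t 0) has_derivative (\<lambda>h. h *\<^sub>R (D' s' q - D' t 0))) (at q within ball 0 \<rho>)"
        by (simp add: scaleR_diff_right)
      have "norm (D' s' q - D' t 0) \<le> \<epsilon>"
        using close[of s' q] s' q by (auto simp: V_def \<rho>_def dist_real_def)
      then show "onorm (\<lambda>h. h *\<^sub>R (D' s' q - D' t 0)) \<le> \<epsilon>"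
        using onorm_scaleR_left[of "\<lambda>h. h" "D' s' q - D' t 0"] by (simp add: onorm_id bounded_linear_ident)
    qed (use r in \<open>auto simp: dist_real_def\<close>)
    show ?thesis
    proof -
      have "norm (K r s - K r t) \<le> (\<epsilon> * \<bar>r\<bar>) * norm (s - t)"
      proof (rule differentiable_bound[OF V(1) _ _ V(2,3), where f' = "\<lambda>s' h. h *\<^sub>R (G' s' r - G' s' 0 - r *\<^sub>R D' t 0)"])
        fix s' assume s': "s' \<in> V"
        have g: "((\<lambda>s. G s r) has_derivative (\<lambda>h. h *\<^sub>R G' s' r)) (at s' within V)"
          "((\<lambda>s. G s 0) has_derivative (\<lambda>h. h *\<^sub>R G' s' 0)) (at s' within V)"
          using G[of s' r] G[of s' 0] s' r e
          by (auto simp: V_def \<rho>_def has_vector_derivative_def intro: has_derivative_subset)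
        show "(K r has_derivative (\<lambda>h. h *\<^sub>R (G' s' r - G' s' 0 - r *\<^sub>R D' t 0))) (at s' within V)"
          unfolding K_def[abs_def]
          by (auto intro!: derivative_eq_intros g simp: algebra_simps)
        show "onorm (\<lambda>h. h *\<^sub>R (G' s' r - G' s' 0 - r *\<^sub>R D' t 0)) \<le> \<epsilon> * \<bar>r\<bar>"
          using onorm_scaleR_left[of "\<lambda>h. h" "G' s' r - G' s' 0 - r *\<^sub>R D' t 0"] G'r[OF s']
          by (simp add: onorm_id bounded_linear_ident algebra_simps)
      qed
      then show ?thesis by simp
    qed
  qed
  show "\<exists>d>0. \<forall>y\<in>J. norm (y - t) < d \<longrightarrow>
      norm (D y - D t - (y - t) *\<^sub>R D' t 0) \<le> \<epsilon> * norm (y - t)"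
  proof (intro exI[of _ \<delta>] conjI ballI impI \<delta>)
    fix s assume s: "s \<in> J" "norm (s - t) < \<delta>"
    have lim: "((\<lambda>r. (G q r - G q 0) /\<^sub>R r) \<longlongrightarrow> D q) (at 0)" if "q \<in> J" for q
    proof -
      have "((\<lambda>r. norm ((G q r - G q 0 - r *\<^sub>R D q) /\<^sub>R \<bar>r\<bar>)) \<longlongrightarrow> 0) (at 0)"
        using D[OF that]
        by (intro tendsto_norm_zero) (simp add: has_vector_derivative_def has_derivative_at_within)
      then have "((\<lambda>r. norm ((G q r - G q 0) /\<^sub>R r - D q)) \<longlongrightarrow> 0) (at 0)"
      proof (rule Lim_transform_eventually)
        have "norm ((G q r - G q 0 - r *\<^sub>R D q) /\<^sub>R \<bar>r\<bar>) = norm ((G q r - G q 0) /\<^sub>R r - D q)"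
          if "r \<noteq> 0" for r
        proof -
          have "(G q r - G q 0) /\<^sub>R r - D q = (G q r - G q 0 - r *\<^sub>R D q) /\<^sub>R r"
            using that by (simp add: scaleR_diff_right)
          then show ?thesis by simp
        qed
        then show "eventually (\<lambda>r. norm ((G q r - G q 0 - r *\<^sub>R D q) /\<^sub>R \<bar>r\<bar>)
            = norm ((G q r - G q 0) /\<^sub>R r - D q)) (at 0)"
          by (simp add: eventually_at_filter)
      qed
      from LIM_zero_cancel[OF tendsto_norm_zero_cancel[OF this]] show ?thesis .
    qed
    \<comment> \<open>Dividing the double difference by \<open>r\<close> and letting
      \<open>r\<close> tend to 0 produces the first-order remainder of \<open>D\<close> at
      \<open>t\<close>; the bound survives the limit.\<close>
    have "((\<lambda>r. norm ((G s r - G s 0) /\<^sub>R r - (G t r - G t 0) /\<^sub>R r - (s - t) *\<^sub>R D' t 0))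
        \<longlongrightarrow> norm (D s - D t - (s - t) *\<^sub>R D' t 0)) (at 0)"
      by (intro tendsto_intros lim s J)
    moreover have "eventually (\<lambda>r. norm ((G s r - G s 0) /\<^sub>R r - (G t r - G t 0) /\<^sub>R r - (s - t) *\<^sub>R D' t 0)
        \<le> \<epsilon> * norm (s - t)) (at 0)"
      unfolding eventually_at
    proof (intro exI[of _ \<rho>] conjI ballI impI \<rho>)
      fix r :: real assume "r \<noteq> 0 \<and> dist r 0 < \<rho>"
      then have r: "r \<noteq> 0" "\<bar>r\<bar> < \<rho>" by auto
      have "(G s r - G s 0) /\<^sub>R r - (G t r - G t 0) /\<^sub>R r - (s - t) *\<^sub>R D' t 0 = (K r s - K r t) /\<^sub>R r"
      proof -
        have *: "r * (a * inverse r) = a" for a using r by simp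
        show ?thesis by (simp add: K_def algebra_simps *)
      qed
      also have "norm \<dots> = norm (K r s - K r t) / \<bar>r\<bar>" by (simp add: divide_inverse_commute)
      also have "\<dots> \<le> \<epsilon> * norm (s - t)"
        using K[OF s(1) _ r(2)] s r by (simp add: pos_divide_le_eq mult_ac)
      finally show "norm ((G s r - G s 0) /\<^sub>R r - (G t r - G t 0) /\<^sub>R r - (s - t) *\<^sub>R D' t 0) \<le> \<epsilon> * norm (s - t)" .
    qed
    ultimately show "norm (D s - D t - (s - t) *\<^sub>R D' t 0) \<le> \<epsilon> * norm (s - t)"
      by (rule tendsto_upperbound) simp
  qed
qed

lemma pd_eqI: "(f has_derivative f') (at u) \<Longrightarrow> pd i f u = f' (axis i 1)"
  unfolding pd_def by (drule frechet_derivative_at) simp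

lemma differentiable_pd:
  "f differentiable (at u) \<Longrightarrow> (f has_derivative frechet_derivative f (at u)) (at u)"
  by (simp add: frechet_derivative_works)

lemma pd_const [simp]: "pd i (\<lambda>u. c) u = 0"
  by (rule pd_eqI[OF has_derivative_const])

lemma pd_add:
  "f differentiable (at u) \<Longrightarrow> g differentiable (at u) \<Longrightarrow> pd i (\<lambda>u. f u + g u) u = pd i f u + pd i g u"
  by (subst pd_eqI[OF has_derivative_add[OF differentiable_pd differentiable_pd]]) (simp_all add: pd_def)

lemma pd_diff:
  "f differentiable (at u) \<Longrightarrow> g differentiable (at u) \<Longrightarrow> pd i (\<lambda>u. f u - g u) u = pd i f u - pd i g u"
  by (subst pd_eqI[OF has_derivative_diff[OF differentiable_pd differentiable_pd]]) (simp_all add: pd_def)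

lemma pd_inner:
  "f differentiable (at u) \<Longrightarrow> g differentiable (at u) \<Longrightarrow>
    pd i (\<lambda>u. f u \<bullet> g u) u = f u \<bullet> pd i g u + pd i f u \<bullet> g u"
  by (subst pd_eqI[OF has_derivative_inner[OF differentiable_pd differentiable_pd]]) (simp_all add: pd_def)

lemma pd_scaleR:
  "f differentiable (at u) \<Longrightarrow> g differentiable (at u) \<Longrightarrow>
    pd i (\<lambda>u. f u *\<^sub>R g u) u = f u *\<^sub>R pd i g u + pd i f u *\<^sub>R g u"
  by (subst pd_eqI[OF has_derivative_scaleR[OF differentiable_pd differentiable_pd]]) (simp_all add: pd_def)

lemma pd_mult:
  fixes f g :: "real ^ 'n::finite \<Rightarrow> real"
  shows "f differentiable (at u) \<Longrightarrow> g differentiable (at u) \<Longrightarrow>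
    pd i (\<lambda>u. f u * g u) u = f u * pd i g u + pd i f u * g u"
  by (subst pd_eqI[OF has_derivative_mult[OF differentiable_pd differentiable_pd]]) (simp_all add: pd_def)

lemma pd_sum:
  "(\<And>a. a \<in> K \<Longrightarrow> f a differentiable (at u)) \<Longrightarrow> pd i (\<lambda>u. \<Sum>a\<in>K. f a u) u = (\<Sum>a\<in>K. pd i (f a) u)"
  by (subst pd_eqI[OF has_derivative_sum[OF differentiable_pd]]) (simp_all add: pd_def)

lemma pd_cong_open:
  assumes "open W" "u \<in> W" "\<And>w. w \<in> W \<Longrightarrow> f w = g w" "f differentiable (at u)"
  shows "pd i f u = pd i g u"
  unfolding pd_def using frechet_derivative_transform_within_open[OF assms(4,1,2)] assms(3) by metis

lemma differentiable_cong_open: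
  assumes "open W" "u \<in> W" "\<And>w. w \<in> W \<Longrightarrow> f w = g w" "f differentiable (at u)"
  shows "g differentiable (at u)"
  using assms(4) unfolding differentiable_def
  using has_derivative_transform_within_open[OF _ assms(1,2)] assms(3) by metis

lemma pd_shift:
  assumes "f differentiable (at (w + a))"
  shows "(\<lambda>w. f (w + a)) differentiable (at w)" "pd i (\<lambda>w. f (w + a)) w = pd i f (w + a)"
proof -
  have "((\<lambda>w. f (w + a)) has_derivative (\<lambda>h. frechet_derivative f (at (w + a)) h)) (at w)"
    by (rule has_derivative_compose[of "\<lambda>w. w + a", where f' = "\<lambda>h. h"])
      (auto intro!: derivative_eq_intros differentiable_pd assms)
  then show "(\<lambda>w. f (w + a)) differentiable (at w)" "pd i (\<lambda>w. f (w + a)) w = pd i f (w + a)"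
    by (rule differentiableI, unfold pd_eqI) (simp add: pd_def)
qed

lemma has_vector_derivative_pd:
  assumes "f differentiable (at (u + r *\<^sub>R axis i 1))"
  shows "((\<lambda>r. f (u + r *\<^sub>R axis i 1)) has_vector_derivative pd i f (u + r *\<^sub>R axis i 1)) (at r)"
proof -
  let ?D = "frechet_derivative f (at (u + r *\<^sub>R axis i 1))"
  have "((\<lambda>r. f (u + r *\<^sub>R axis i 1)) has_derivative (\<lambda>h. ?D (h *\<^sub>R axis i 1))) (at r)"
    by (rule has_derivative_compose[of "\<lambda>r. u + r *\<^sub>R axis i 1"])
      (auto intro!: derivative_eq_intros differentiable_pd assms)
  moreover have "?D (h *\<^sub>R axis i 1) = h *\<^sub>R pd i f (u + r *\<^sub>R axis i 1)" for h
    using linear_frechet_derivative[OF assms] by (simp add: pd_def linear_cmul)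
  ultimately show ?thesis by (simp add: has_vector_derivative_def)
qed

text \<open>Restricting to the coordinate line through \<open>u\<close> in direction
  \<open>i\<close> reduces the exchange of time and space derivatives to
  \<open>interchange_derivatives\<close>; joint continuity of the mixed derivative supplies its
  \<open>cont\<close> hypothesis.\<close>

lemma has_vector_derivative_time_pd:
  fixes F F' :: "real \<Rightarrow> real ^ 'n::finite \<Rightarrow> 'e::real_normed_vector"
  assumes J: "convex J" "t \<in> J" and W: "open W" "u \<in> W"
    and F: "\<And>s w. s \<in> J \<Longrightarrow> w \<in> W \<Longrightarrow> ((\<lambda>s. F s w) has_vector_derivative F' s w) (at s within J)"
    and dF: "\<And>s w. s \<in> J \<Longrightarrow> w \<in> W \<Longrightarrow> F s differentiable (at w)"
    and dF': "\<And>s w. s \<in> J \<Longrightarrow> w \<in> W \<Longrightarrow> F' s differentiable (at w)"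
    and cont: "continuous_on (J \<times> W) (\<lambda>(s, w). pd i (F' s) w)"
  shows "((\<lambda>s. pd i (F s) u) has_vector_derivative pd i (F' t) u) (at t within J)"
proof -
  obtain e where e: "e > 0" "ball u e \<subseteq> W" using W open_contains_ball by blast
  let ?p = "\<lambda>r. u + r *\<^sub>R axis i 1"
  have p: "?p r \<in> W" if "\<bar>r\<bar> < e" for r
  proof -
    have "dist u (?p r) = \<bar>r\<bar>" by (simp add: dist_norm)
    then show ?thesis using that e by auto
  qed
  have "((\<lambda>s. pd i (F s) u) has_vector_derivative pd i (F' t) (?p 0)) (at t within J)"
  proof (rule interchange_derivatives[OF J e(1), where G = "\<lambda>s r. F s (?p r)"
        and G' = "\<lambda>s r. F' s (?p r)" and D' = "\<lambda>s r. pd i (F' s) (?p r)"])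
    fix s assume "s \<in> J"
    then show "((\<lambda>r. F s (?p r)) has_vector_derivative pd i (F s) u) (at 0)"
      using has_vector_derivative_pd[of "F s" u 0 i] dF W by simp
  next
    fix \<epsilon> :: real assume \<epsilon>: "0 < \<epsilon>"
    have "(t, u) \<in> J \<times> W" using J W by simp
    with cont \<epsilon> obtain d where d: "d > 0"
      "\<And>z. z \<in> J \<times> W \<Longrightarrow> dist z (t, u) < d \<Longrightarrow>
        dist (case z of (s, w) \<Rightarrow> pd i (F' s) w) (case (t, u) of (s, w) \<Rightarrow> pd i (F' s) w) < \<epsilon>"
      unfolding continuous_on_iff by metis
    let ?d = "min (d / 2) e"
    show "\<exists>\<delta>>0. \<forall>s\<in>J. \<forall>r. \<bar>s - t\<bar> < \<delta> \<longrightarrow> \<bar>r\<bar> < \<delta> \<longrightarrow>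
        norm (pd i (F' s) (?p r) - pd i (F' t) (?p 0)) \<le> \<epsilon>"
    proof (intro exI[of _ ?d] conjI ballI allI impI)
      show "0 < ?d" using d(1) e(1) by simp
      fix s r assume s: "s \<in> J" "\<bar>s - t\<bar> < ?d" "\<bar>r\<bar> < ?d"
      have "dist (s, ?p r) (t, u) \<le> dist s t + dist (?p r) u"
        unfolding dist_Pair_Pair by (rule sqrt_sum_squares_le_sum) auto
      also have "\<dots> < d" using s by (simp add: dist_norm dist_real_def)
      finally show "norm (pd i (F' s) (?p r) - pd i (F' t) (?p 0)) \<le> \<epsilon>"
        using d(2)[of "(s, ?p r)"] s p[of r] by (simp add: dist_norm)
    qed
  qed (use F dF' p in \<open>auto intro!: has_vector_derivative_pd\<close>)
  then show ?thesis by simp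
qed

text \<open>Translation along direction \<open>j\<close> plays the part of time: the family
  \<open>f (w + s *\<^sub>R axis j 1)\<close> has time derivative \<open>pd j f\<close> at the
  shifted point, so the exchange of time and space derivatives gives the symmetry.\<close>

lemma pd_commute:
  fixes f :: "real ^ 'n::finite \<Rightarrow> 'e::real_normed_vector"
  assumes W: "open W" "u \<in> W"
    and f: "\<And>w. w \<in> W \<Longrightarrow> f differentiable (at w)"
    and df: "\<And>w k. w \<in> W \<Longrightarrow> pd k f differentiable (at w)"
    and cont: "continuous_on W (pd i (pd j f))"
  shows "pd i (pd j f) u = pd j (pd i f) u"
proof -
  obtain e where e: "e > 0" "ball u e \<subseteq> W" using W open_contains_ball by blast
  define J where "J = {- e / 2 <..< e / 2}"
  define V where "V = ball u (e / 2)"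
  let ?a = "\<lambda>s. s *\<^sub>R axis j 1"
  have V: "w + ?a s \<in> W" if "s \<in> J" "w \<in> V" for s w
  proof -
    have "dist u (w + ?a s) \<le> dist u w + dist w (w + ?a s)" by (rule dist_triangle)
    also have "dist w (w + ?a s) = \<bar>s\<bar>" by (simp add: dist_norm)
    finally have "dist u (w + ?a s) < e" using that by (auto simp: J_def V_def)
    then show ?thesis using e by auto
  qed
  have J: "open J" "convex J" "0 \<in> J" using e by (auto simp: J_def)
  have cont': "continuous_on (J \<times> V) (\<lambda>(s, w). pd i (pd j f) (w + ?a s))"
    unfolding case_prod_beta
    by (rule continuous_on_compose2[OF cont]) (auto intro!: continuous_intros V)
  have "((\<lambda>s. pd i (\<lambda>w. f (w + ?a s)) u) has_vector_derivative pd i (\<lambda>w. pd j f (w + ?a 0)) u) (at 0 within J)"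
  proof (rule has_vector_derivative_time_pd[OF J(2,3), of V])
    show "((\<lambda>s. f (w + ?a s)) has_vector_derivative pd j f (w + ?a s)) (at s within J)"
      if "s \<in> J" "w \<in> V" for s w
      using has_vector_derivative_pd[OF f[OF V[OF that]]] by (rule has_vector_derivative_at_within)
    show "continuous_on (J \<times> V) (\<lambda>(s, w). pd i (\<lambda>w. pd j f (w + ?a s)) w)"
      using cont' by (rule continuous_on_eq) (auto simp: pd_shift(2)[OF df[OF V]])
    show "(\<lambda>w. f (w + ?a s)) differentiable (at w)" "(\<lambda>w. pd j f (w + ?a s)) differentiable (at w)"
      if "s \<in> J" "w \<in> V" for s w
      by (rule pd_shift(1)[OF f[OF V[OF that]]], rule pd_shift(1)[OF df[OF V[OF that]]])
    show "open V" "u \<in> V" using e by (auto simp: V_def)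
  qed
  then have "((\<lambda>s. pd i (\<lambda>w. f (w + ?a s)) u) has_vector_derivative pd i (pd j f) u) (at 0)"
    unfolding at_within_open[OF J(3,1)] scaleR_zero_left add_0_right .
  then have 1: "((\<lambda>s. pd i f (u + ?a s)) has_vector_derivative pd i (pd j f) u) (at 0)"
  proof (rule has_vector_derivative_transform_within_open[OF _ J(1,3)])
    fix s assume "s \<in> J"
    then have "u + ?a s \<in> W" using V[of s u] e by (simp add: V_def)
    then show "pd i (\<lambda>w. f (w + ?a s)) u = pd i f (u + ?a s)" by (intro pd_shift(2) f)
  qed
  have "((\<lambda>s. pd i f (u + ?a s)) has_vector_derivative pd j (pd i f) u) (at 0)"
    using has_vector_derivative_pd[of "pd i f" u 0 j] df[OF W(2)] by simp
  with 1 show ?thesis by (rule vector_derivative_unique_at)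
qed

section \<open>Smooth maps and smooth families under partial differentiation\<close>

lemma smooth_on_differentiable: "smooth_on W f \<Longrightarrow> u \<in> W \<Longrightarrow> f differentiable (at u)"
  unfolding smooth_on_def by (drule spec[of _ "Suc 0"]) simp

lemma smooth_on_continuous: "smooth_on W f \<Longrightarrow> continuous_on W f"
  unfolding smooth_on_def by (drule spec[of _ 0]) simp

lemma smooth_on_pd: "smooth_on W f \<Longrightarrow> smooth_on W (pd i f)"
  unfolding smooth_on_def pd_def[abs_def] by (metis Ck_on.simps(2))

lemma smooth_on_pd_commute:
  assumes "open W" "u \<in> W" "smooth_on W f"
  shows "pd i (pd j f) u = pd j (pd i f) u"
  using assms(1,2)
  by (rule pd_commute) (blast intro: smooth_on_differentiable smooth_on_continuous smooth_on_pd assms(3))+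

lemma space_smooth_differentiable:
  "space_smooth I W F \<Longrightarrow> t \<in> I \<Longrightarrow> u \<in> W \<Longrightarrow> F t differentiable (at u)"
  unfolding space_smooth_def by (drule spec[of _ "Suc 0"]) simp

lemma space_smooth_continuous: "space_smooth I W F \<Longrightarrow> continuous_on (I \<times> W) (\<lambda>(t, u). F t u)"
  unfolding space_smooth_def by (drule spec[of _ 0]) simp

lemma space_smooth_pd: "space_smooth I W F \<Longrightarrow> space_smooth I W (\<lambda>t. pd i (F t))"
  unfolding space_smooth_def pd_def[abs_def] by (metis space_Ck.simps(2))

subsection \<open>Simons' identity for an immersed patch\<close>

lemma metric_inv_gram: "metric_inv f u = matrix_inv (gram (\<lambda>i. pd i f u))"
  by (simp add: metric_inv_def ind_metric_def gram_def)

lemma christoffel_dual: "christoffel f k i j u = pd i (pd j f) u \<bullet> dual_frame (\<lambda>i. pd i f u) k"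
  by (simp add: christoffel_def dual_frame_def metric_inv_gram inner_sum_right)

text \<open>One time slice read in one chart. Independence of the tangent vectors and codimension
  one are contained in \<open>normal\<close>.\<close>

locale immersed_patch =
  fixes W :: "(real ^ 'n::finite) set" and f N :: "real ^ 'n \<Rightarrow> 'e::euclidean_space"
  assumes open_W: "open W" and smooth: "smooth_on W f"
    and normal: "u \<in> W \<Longrightarrow> normal_frame (\<lambda>i. pd i f u) (N u)"
    and continuous_N: "continuous_on W N"
begin

abbreviation "h \<equiv> second_ff f N"
abbreviation "H \<equiv> mean_curv f N"
abbreviation "gi u k l \<equiv> metric_inv f u $ k $ l"
abbreviation "\<Gamma> \<equiv> christoffel f"
abbreviation "dual u k \<equiv> dual_frame (\<lambda>i. pd i f u) k"

lemmas inv_gram = normal_frame_invertible[OF normal]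
lemmas frame_inner = normal_frame_inner[OF normal]

lemma diff_X:
  assumes "u \<in> W"
  shows "pd i f differentiable (at u)" "pd i (pd j f) differentiable (at u)"
    "pd i (pd j (pd k f)) differentiable (at u)"
  by (rule smooth_on_differentiable[OF _ assms], intro smooth_on_pd smooth)+

lemma X2_sym: "u \<in> W \<Longrightarrow> pd i (pd j f) u = pd j (pd i f) u"
  using open_W _ smooth by (rule smooth_on_pd_commute)

lemma X3_sym:
  assumes "u \<in> W"
  shows "pd i (pd j (pd k f)) u = pd j (pd i (pd k f)) u"
    "pd i (pd j (pd k f)) u = pd i (pd k (pd j f)) u"
  using open_W assms by (blast intro: smooth_on_pd_commute smooth_on_pd smooth)
    (rule pd_cong_open[OF open_W assms X2_sym diff_X(2)[OF assms]])

text \<open>Adjacent transpositions generate the permutation. It is the one that takes the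
  fourth-order term of \<open>nabla2_h k l i j\<close> to that of
  \<open>nabla2_h i l j k\<close>.\<close>

lemma X4_sym:
  assumes "u \<in> W"
  shows "pd i (pd j (pd k (pd l f))) u = pd k (pd j (pd l (pd i f))) u"
proof -
  have 1: "pd a (pd b (pd c (pd d f))) u = pd b (pd a (pd c (pd d f))) u" for a b c d
    using open_W assms by (blast intro: smooth_on_pd_commute smooth_on_pd smooth)
  have 2: "pd a (pd b (pd c (pd d f))) u = pd a (pd c (pd b (pd d f))) u" for a b c d
    by (rule pd_cong_open[OF open_W assms X3_sym(1) diff_X(3)[OF assms]])
  have 3: "pd a (pd b (pd c (pd d f))) u = pd a (pd b (pd d (pd c f))) u" for a b c d
    by (rule pd_cong_open[OF open_W assms X3_sym(2) diff_X(3)[OF assms]])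
  have "pd i (pd j (pd k (pd l f))) u = pd i (pd k (pd j (pd l f))) u" by (rule 2)
  also have "\<dots> = pd k (pd i (pd j (pd l f))) u" by (rule 1)
  also have "\<dots> = pd k (pd j (pd i (pd l f))) u" by (rule 2)
  also have "\<dots> = pd k (pd j (pd l (pd i f))) u" by (rule 3)
  finally show ?thesis .
qed

lemma at_within_W: "u \<in> W \<Longrightarrow> at u within W = at u"
  using open_W by (rule at_within_open[rotated])

lemma diff_N:
  assumes u: "u \<in> W"
  shows "N differentiable (at u)"
proof -
  have "N differentiable (at u within W)"
    by (rule differentiable_normal[OF _ u normal])
      (use u continuous_N in \<open>auto simp: diff_X at_within_W continuous_on_eq_continuous_within\<close>)
  then show ?thesis by (simp add: at_within_W u)
qed

lemma diff_dual: "u \<in> W \<Longrightarrow> (\<lambda>u. dual u k) differentiable (at u)"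
  using differentiable_dual_frame[of "\<lambda>u i. pd i f u" u W k] inv_gram
  by (simp add: diff_X at_within_W)

lemma diff_gi: "u \<in> W \<Longrightarrow> (\<lambda>u. gi u k l) differentiable (at u)"
  using differentiable_gram_inv[of "\<lambda>u i. pd i f u" u W k l] inv_gram
  by (simp add: diff_X at_within_W metric_inv_gram)

lemma diff_h: "u \<in> W \<Longrightarrow> h i j differentiable (at u)"
  unfolding second_ff_def[abs_def] by (intro differentiable_inner diff_N diff_X)

section \<open>Weingarten's formula and the third fundamental form\<close>

lemma pd_N_inner_X: "u \<in> W \<Longrightarrow> pd i N u \<bullet> pd j f u = - h i j u"
proof -
  assume u: "u \<in> W"
  have "pd i (\<lambda>u. N u \<bullet> pd j f u) u = pd i (\<lambda>u. 0) u"
    using frame_inner(2) by (intro pd_cong_open[OF open_W u] differentiable_inner diff_N diff_X u)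
  then show ?thesis by (simp add: pd_inner diff_N diff_X u second_ff_def)
qed

lemma pd_N_inner_N: "u \<in> W \<Longrightarrow> pd i N u \<bullet> N u = 0"
proof -
  assume u: "u \<in> W"
  have "pd i (\<lambda>u. N u \<bullet> N u) u = pd i (\<lambda>u. 1) u"
    using frame_inner(1) by (intro pd_cong_open[OF open_W u] differentiable_inner diff_N u)
  then show ?thesis by (simp add: pd_inner diff_N u inner_commute)
qed

lemma weingarten: "u \<in> W \<Longrightarrow> pd i N u = (\<Sum>k\<in>UNIV. (- h i k u) *\<^sub>R dual u k)"
  using normal_frame_expand_dual[OF normal, of u "pd i N u"]
  by (simp add: pd_N_inner_X pd_N_inner_N)

text \<open>The right side of Weingarten's formula contains \<open>N\<close> only undifferentiated,
  so one derivative of \<open>N\<close> yields a second.\<close>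

lemma diff_pd_N:
  assumes u: "u \<in> W"
  shows "pd i N differentiable (at u)"
proof (rule differentiable_cong_open[OF open_W u])
  show "(\<lambda>u. \<Sum>k\<in>UNIV. (- h i k u) *\<^sub>R dual u k) differentiable (at u)"
    by (intro differentiable_sum ballI differentiable_scaleR differentiable_minus diff_h diff_dual u) simp
qed (simp add: weingarten)

lemma h_sym: "u \<in> W \<Longrightarrow> h i j u = h j i u"
  by (simp add: second_ff_def X2_sym)

lemma pd_N_inner_pd_N:
  assumes u: "u \<in> W"
  shows "pd i N u \<bullet> pd j N u = (\<Sum>l\<in>UNIV. \<Sum>m\<in>UNIV. h i l u * h m j u * gi u l m)"
proof -
  have "dual u l \<bullet> pd j N u = - (\<Sum>m\<in>UNIV. h j m u * gi u l m)" for l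
    by (simp add: weingarten u inner_sum_right inner_dual_dual[OF inv_gram[OF u]] metric_inv_gram sum_negf)
  then have "pd i N u \<bullet> pd j N u = (\<Sum>l\<in>UNIV. h i l u * (\<Sum>m\<in>UNIV. h j m u * gi u l m))"
    by (subst weingarten[OF u]) (simp add: inner_sum_left)
  then show ?thesis by (simp add: h_sym[OF u, of j] mult.assoc sum_distrib_left)
qed

text \<open>The products \<open>pd k N u \<bullet> pd l N u\<close> form the third fundamental form,
  whose metric trace is the squared norm of the second.\<close>

lemma normsq_A_eq:
  assumes u: "u \<in> W"
  shows "normsq_A f N u = (\<Sum>k\<in>UNIV. \<Sum>l\<in>UNIV. gi u k l * (pd k N u \<bullet> pd l N u))"
  unfolding normsq_A_def pd_N_inner_pd_N[OF u]
  by (simp add: sum_distrib_left h_sym[OF u] mult_ac)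

lemma christoffel_sum_inner:
  assumes u: "u \<in> W"
  shows "(\<Sum>m\<in>UNIV. \<Gamma> m k i u * (pd m f u \<bullet> w)) = pd k (pd i f) u \<bullet> w - h k i u * (N u \<bullet> w)"
  using normal_frame_inner_expand[OF normal[OF u], of "pd k (pd i f) u" w]
  by (simp add: christoffel_dual second_ff_def inner_commute)

text \<open>Pair the Gauss formula with \<open>pd j N u\<close>; the normal term drops out because
  derivatives of \<open>N\<close> are tangential.\<close>

lemma christoffel_sum_h:
  assumes u: "u \<in> W"
  shows "(\<Sum>m\<in>UNIV. \<Gamma> m k i u * h m j u) = - (pd k (pd i f) u \<bullet> pd j N u)"
proof -
  have "h m j u = - (pd m f u \<bullet> pd j N u)" for m
    by (simp add: inner_commute[of "pd m f u"] pd_N_inner_X u h_sym[OF u, of m j])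
  then show ?thesis
    using christoffel_sum_inner[OF u, of k i "pd j N u"]
    by (simp add: sum_negf inner_commute[of "N u"] pd_N_inner_N u)
qed

text \<open>The shape operator is self-adjoint.\<close>

lemma shape_sym:
  assumes u: "u \<in> W"
  shows "(\<Sum>m\<in>UNIV. (v \<bullet> dual u m) * (pd m N u \<bullet> w)) = (\<Sum>m\<in>UNIV. (w \<bullet> dual u m) * (pd m N u \<bullet> v))"
proof -
  have eq: "(\<Sum>m\<in>UNIV. (v \<bullet> dual u m) * (pd m N u \<bullet> w))
      = (\<Sum>m\<in>UNIV. \<Sum>p\<in>UNIV. - (h m p u * (v \<bullet> dual u m) * (w \<bullet> dual u p)))" for v w
    by (simp add: weingarten u inner_sum_left sum_distrib_left sum_negf inner_commute[of w] mult_ac)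
  show ?thesis unfolding eq
    by (subst sum.swap) (simp add: h_sym[OF u] mult_ac)
qed

text \<open>The components \<open>\<nabla>\<^sub>l h\<^sub>i\<^sub>j\<close>. Written with ambient derivatives, the Codazzi equation is the
  evident symmetry of this expression.\<close>

definition nabla_h :: "'n \<Rightarrow> 'n \<Rightarrow> 'n \<Rightarrow> real ^ 'n \<Rightarrow> real" where
  "nabla_h l i j u = N u \<bullet> pd l (pd i (pd j f)) u + pd l N u \<bullet> pd i (pd j f) u
     + pd i N u \<bullet> pd l (pd j f) u + pd j N u \<bullet> pd l (pd i f) u"

lemma codazzi:
  assumes "u \<in> W"
  shows "nabla_h l i j u = nabla_h i l j u" "nabla_h l i j u = nabla_h l j i u"
  unfolding nabla_h_def using X3_sym[OF assms, of l i j] X2_sym[OF assms] by simp_all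

lemma diff_nabla_h: "u \<in> W \<Longrightarrow> nabla_h l i j differentiable (at u)"
  unfolding nabla_h_def[abs_def]
  by (intro differentiable_add differentiable_inner diff_N diff_X diff_pd_N)

text \<open>The second fundamental form in the index-list encoding of \<open>cov_deriv\<close>;
  \<open>Suc 0\<close> is the form to which the simplifier brings the index 1.\<close>

abbreviation "hT is \<equiv> h (is ! 0) (is ! Suc 0)"

lemma pd_h: "u \<in> W \<Longrightarrow> pd l (h i j) u = N u \<bullet> pd l (pd i (pd j f)) u + pd l N u \<bullet> pd i (pd j f) u"
  unfolding second_ff_def[abs_def] by (simp add: pd_inner diff_N diff_X)

lemma nabla_h_christoffel:
  assumes u: "u \<in> W"
  shows "pd l (h i j) u - (\<Sum>m\<in>UNIV. \<Gamma> m l i u * h m j u) - (\<Sum>m\<in>UNIV. \<Gamma> m l j u * h i m u) = nabla_h l i j u"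
  unfolding nabla_h_def h_sym[OF u, of i] christoffel_sum_h[OF u] pd_h[OF u]
  by (simp add: inner_commute)

lemma cov_deriv_h: "u \<in> W \<Longrightarrow> cov_deriv f hT [l, i, j] u = nabla_h l i j u"
  using nabla_h_christoffel[of u l i j] by (simp add: lessThan_Suc numeral_2_eq_2 algebra_simps)

text \<open>The second covariant derivative of \<open>h\<close>, written over \<open>nabla_h\<close>
  because \<open>cov_deriv f hT\<close> is identified with \<open>nabla_h\<close> on
  \<open>W\<close> only. As \<open>W\<close> is open, this suffices for differentiating once
  more.\<close>

definition nabla2_h :: "'n \<Rightarrow> 'n \<Rightarrow> 'n \<Rightarrow> 'n \<Rightarrow> real ^ 'n \<Rightarrow> real" where
  "nabla2_h k l i j u = pd k (nabla_h l i j) u - (\<Sum>m\<in>UNIV. \<Gamma> m k l u * nabla_h m i j u)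
     - (\<Sum>m\<in>UNIV. \<Gamma> m k i u * nabla_h l m j u) - (\<Sum>m\<in>UNIV. \<Gamma> m k j u * nabla_h l i m u)"

lemma cov_deriv2_h:
  assumes u: "u \<in> W"
  shows "cov_deriv f (cov_deriv f hT) [k, l, i, j] u = nabla2_h k l i j u"
proof -
  have "pd k (cov_deriv f hT [l, i, j]) u = pd k (nabla_h l i j) u"
    by (rule pd_cong_open[OF open_W u, symmetric]) (simp_all only: cov_deriv_h diff_nabla_h u)
  then show ?thesis
    unfolding cov_deriv.simps(2)[of f "cov_deriv f hT" k]
    by (simp add: lessThan_Suc nabla2_h_def cov_deriv_h u numeral_2_eq_2 del: cov_deriv.simps)
qed

text \<open>Differentiate \<open>pd i N u \<bullet> pd m f u = - h i m u\<close> in direction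
  \<open>j\<close>. The result is linear in the vectors carrying the index \<open>m\<close>, so a
  sum against Christoffel symbols can be evaluated by the Gauss formula.\<close>

lemma nabla_h_alt:
  assumes u: "u \<in> W"
  shows "nabla_h m i j u = pd m N u \<bullet> pd i (pd j f) u - pd j (pd i N) u \<bullet> pd m f u"
proof -
  have "pd j (\<lambda>u. pd i N u \<bullet> pd m f u) u = pd j (\<lambda>u. - h i m u) u"
    by (intro pd_cong_open[OF open_W u] differentiable_inner diff_pd_N diff_X u) (simp add: pd_N_inner_X)
  moreover have "pd j (\<lambda>u. - h i m u) u = - pd j (h i m) u"
    using pd_diff[of "\<lambda>u. 0" u "h i m" j] by (simp add: diff_h u)
  ultimately have "pd i N u \<bullet> pd j (pd m f) u + pd j (pd i N) u \<bullet> pd m f u = - pd j (h i m) u"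
    by (simp add: pd_inner diff_pd_N diff_X u)
  then show ?thesis
    using X3_sym[OF u] X2_sym[OF u] unfolding pd_h[OF u] nabla_h_def by (smt (verit))
qed

lemma pd_pd_N_inner_N:
  assumes u: "u \<in> W"
  shows "pd j (pd i N) u \<bullet> N u = - (pd i N u \<bullet> pd j N u)"
proof -
  have "pd j (\<lambda>u. pd i N u \<bullet> N u) u = pd j (\<lambda>u. 0) u"
    by (intro pd_cong_open[OF open_W u] differentiable_inner diff_pd_N diff_N u) (simp add: pd_N_inner_N)
  then show ?thesis by (simp add: pd_inner diff_pd_N diff_N u)
qed

text \<open>Continuity of the second derivatives of \<open>N\<close> has not been established, so
  \<open>pd_commute\<close> does not apply directly. Instead components are compared: the tangential
  ones agree by the symmetry of \<open>nabla_h\<close> in its last two indices, the normal ones by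
  symmetry of the inner product.\<close>

lemma N2_sym:
  assumes u: "u \<in> W"
  shows "pd i (pd j N) u = pd j (pd i N) u"
proof (rule normal_frame_eqI[OF normal[OF u]])
  fix k
  show "pd i (pd j N) u \<bullet> pd k f u = pd j (pd i N) u \<bullet> pd k f u"
    using nabla_h_alt[OF u, of k i j] nabla_h_alt[OF u, of k j i] codazzi(2)[OF u, of k i j] X2_sym[OF u, of i j]
    by simp
  show "pd i (pd j N) u \<bullet> N u = pd j (pd i N) u \<bullet> N u"
    unfolding pd_pd_N_inner_N[OF u] by (simp add: inner_commute)
qed

text \<open>Insert \<open>nabla_h_alt\<close> and sum with the Gauss formula. Second derivatives of
  \<open>N\<close> have a normal component, and this produces the last term, from which the
  curvature terms of the Ricci identity arise.\<close>

lemma christoffel_sum_nabla_h: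
  assumes u: "u \<in> W"
  shows "(\<Sum>m\<in>UNIV. \<Gamma> m k l u * nabla_h m i j u) =
    (\<Sum>m\<in>UNIV. (pd k (pd l f) u \<bullet> dual u m) * (pd m N u \<bullet> pd i (pd j f) u))
    - pd i (pd j N) u \<bullet> pd k (pd l f) u - h k l u * (pd i N u \<bullet> pd j N u)"
proof -
  have "(\<Sum>m\<in>UNIV. \<Gamma> m k l u * nabla_h m i j u) =
      (\<Sum>m\<in>UNIV. \<Gamma> m k l u * (pd m N u \<bullet> pd i (pd j f) u))
      - (\<Sum>m\<in>UNIV. \<Gamma> m k l u * (pd m f u \<bullet> pd i (pd j N) u))"
    by (simp add: nabla_h_alt u N2_sym[OF u, of i j] right_diff_distrib sum_subtractf inner_commute)
  also have "(\<Sum>m\<in>UNIV. \<Gamma> m k l u * (pd m f u \<bullet> pd i (pd j N) u))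
      = pd i (pd j N) u \<bullet> pd k (pd l f) u + h k l u * (pd i N u \<bullet> pd j N u)"
    unfolding christoffel_sum_inner[OF u]
    using pd_pd_N_inner_N[OF u, of i j] by (simp add: inner_commute)
  finally show ?thesis by (simp add: christoffel_dual)
qed

lemma pd_nabla_h:
  assumes u: "u \<in> W"
  shows "pd k (nabla_h l i j) u =
    N u \<bullet> pd k (pd l (pd i (pd j f))) u + pd k N u \<bullet> pd l (pd i (pd j f)) u
    + (pd l N u \<bullet> pd k (pd i (pd j f)) u + pd k (pd l N) u \<bullet> pd i (pd j f) u)
    + (pd i N u \<bullet> pd k (pd l (pd j f)) u + pd k (pd i N) u \<bullet> pd l (pd j f) u)
    + (pd j N u \<bullet> pd k (pd l (pd i f)) u + pd k (pd j N) u \<bullet> pd l (pd i f) u)"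
  unfolding nabla_h_def[abs_def]
  by (simp add: pd_add pd_inner differentiable_add differentiable_inner diff_N diff_X diff_pd_N u)

text \<open>The Ricci identity for \<open>h\<close>, with the curvature expressed by the Gauss equation.\<close>

lemma nabla2_h_commute:
  assumes u: "u \<in> W"
  shows "nabla2_h k l i j u - nabla2_h i l j k u =
    h k l u * (pd i N u \<bullet> pd j N u) + h k j u * (pd l N u \<bullet> pd i N u)
    - h i l u * (pd j N u \<bullet> pd k N u) - h i j u * (pd l N u \<bullet> pd k N u)"
proof -
  \<comment> \<open>Codazzi moves the summation index to the first slot, where
    \<open>christoffel_sum_nabla_h\<close> applies to all three Christoffel sums.\<close>
  have c: "nabla_h l m j u = nabla_h m l j u" "nabla_h l i m u = nabla_h m l i u" for l i j m
    using codazzi[OF u] by metis+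
  have "N u \<bullet> pd k (pd l (pd i (pd j f))) u = N u \<bullet> pd i (pd l (pd j (pd k f))) u"
    by (simp add: X4_sym[OF u, of k l i j])
  moreover have "pd l (pd i (pd j f)) u = pd l (pd j (pd i f)) u" 
     "pd k (pd i (pd j f)) u = pd i (pd j (pd k f)) u"
     "pd k (pd l (pd j f)) u = pd l (pd j (pd k f)) u"
     "pd k (pd l (pd i f)) u = pd i (pd l (pd k f)) u"
     "pd i (pd l (pd j f)) u = pd l (pd i (pd j f)) u"
    using X3_sym[OF u] by metis+
  moreover note X2_sym[OF u, of i j] X2_sym[OF u, of i l] X2_sym[OF u, of k j] X2_sym[OF u, of k l]
    X2_sym[OF u, of i k] X2_sym[OF u, of l j]
  moreover note N2_sym[OF u, of i j] N2_sym[OF u, of i l] N2_sym[OF u, of k j] N2_sym[OF u, of k l]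
    N2_sym[OF u, of i k] N2_sym[OF u, of l j]
  \<comment> \<open>The remaining shape operator sums of the two sides differ only by exchanging the
    two second derivatives of \<open>f\<close>; self-adjointness cancels them.\<close>
  moreover note shape_sym[OF u, of "pd k (pd l f) u" "pd i (pd j f) u"]
    shape_sym[OF u, of "pd k (pd j f) u" "pd i (pd l f) u"]
  moreover note h_sym[OF u, of i k] h_sym[OF u, of i j] h_sym[OF u, of i l] h_sym[OF u, of k j] h_sym[OF u, of k l]
  ultimately show ?thesis
    unfolding nabla2_h_def c christoffel_sum_nabla_h[OF u] pd_nabla_h[OF u]
    by (simp add: inner_commute)
qed

end

section \<open>Metric traces, the Hessian of the mean curvature and Simons' identity\<close>

context immersed_patch
begin

lemma pd_dual_inner_X:
  assumes u: "u \<in> W"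
  shows "pd i (\<lambda>u. dual u k) u \<bullet> pd a f u = - \<Gamma> k i a u"
proof -
  have "pd i (\<lambda>u. pd a f u \<bullet> dual u k) u = pd i (\<lambda>u. if a = k then 1 else 0) u"
    by (intro pd_cong_open[OF open_W u] differentiable_inner diff_dual diff_X u)
      (simp add: inner_dual_frame[OF inv_gram])
  then have "pd a f u \<bullet> pd i (\<lambda>u. dual u k) u + pd i (pd a f) u \<bullet> dual u k = 0"
    by (simp add: pd_inner diff_dual diff_X u)
  then show ?thesis by (simp add: christoffel_dual inner_commute)
qed

text \<open>The inverse metric is parallel. The product rule is applied to the inner product of two
  dual vectors, whose derivatives have Christoffel symbols as tangential components.\<close>

lemma pd_gi:
  assumes u: "u \<in> W"
  shows "pd i (\<lambda>u. gi u k l) u = - (\<Sum>m\<in>UNIV. gi u m l * \<Gamma> k i m u) - (\<Sum>m\<in>UNIV. gi u k m * \<Gamma> l i m u)"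
proof -
  have eq: "gi u k l = dual u k \<bullet> dual u l" if "u \<in> W" for u
    by (simp add: inner_dual_dual inv_gram that metric_inv_gram)
  have sym: "gi u k l = gi u l k" for k l
    unfolding metric_inv_gram by (rule gram_inv_sym[OF inv_gram[OF u]])
  have "pd i (\<lambda>u. dual u k) u \<bullet> dual u l = - (\<Sum>m\<in>UNIV. gi u l m * \<Gamma> k i m u)" for k l
    by (subst (2) dual_frame_def)
      (simp add: inner_sum_right pd_dual_inner_X u metric_inv_gram[symmetric] sum_negf)
  moreover have "pd i (\<lambda>u. gi u k l) u = pd i (\<lambda>u. dual u k \<bullet> dual u l) u"
    by (rule pd_cong_open[OF open_W u eq diff_gi[OF u]])
  ultimately show ?thesis
    by (simp add: pd_inner diff_dual u inner_commute[of "dual u k"] sym[of l])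
qed

text \<open>Metric compatibility: covariant differentiation commutes with contraction by \<open>g\<^sup>k\<^sup>l\<close>.\<close>

lemma pd_trace:
  assumes u: "u \<in> W" and T: "\<And>k l. T k l differentiable (at u)"
  shows "pd i (\<lambda>u. \<Sum>k\<in>UNIV. \<Sum>l\<in>UNIV. gi u k l * T k l u) u =
    (\<Sum>k\<in>UNIV. \<Sum>l\<in>UNIV. gi u k l * (pd i (T k l) u
      - (\<Sum>m\<in>UNIV. \<Gamma> m i k u * T m l u) - (\<Sum>m\<in>UNIV. \<Gamma> m i l u * T k m u)))"
proof -
  have "pd i (\<lambda>u. \<Sum>k\<in>UNIV. \<Sum>l\<in>UNIV. gi u k l * T k l u) u =
      (\<Sum>k\<in>UNIV. \<Sum>l\<in>UNIV. gi u k l * pd i (T k l) u + pd i (\<lambda>u. gi u k l) u * T k l u)"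
    by (simp add: pd_sum pd_mult diff_gi u T differentiable_sum differentiable_mult)
  also have "\<dots> = (\<Sum>k\<in>UNIV. \<Sum>l\<in>UNIV. gi u k l * pd i (T k l) u)
      - (\<Sum>k\<in>UNIV. \<Sum>l\<in>UNIV. \<Sum>m\<in>UNIV. gi u m l * \<Gamma> k i m u * T k l u)
      - (\<Sum>k\<in>UNIV. \<Sum>l\<in>UNIV. \<Sum>m\<in>UNIV. gi u k m * \<Gamma> l i m u * T k l u)"
    by (simp add: pd_gi u sum.distrib sum_subtractf left_diff_distrib sum_distrib_right sum_negf)
  \<comment> \<open>Renaming summation indices transfers the Christoffel symbol from the inverse
    metric to the tensor.\<close>
  also have "(\<Sum>k\<in>UNIV. \<Sum>l\<in>UNIV. \<Sum>m\<in>UNIV. gi u m l * \<Gamma> k i m u * T k l u)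
      = (\<Sum>k\<in>UNIV. \<Sum>l\<in>UNIV. \<Sum>m\<in>UNIV. gi u k l * (\<Gamma> m i k u * T m l u))"
  proof -
    have "(\<Sum>k\<in>UNIV. \<Sum>l\<in>UNIV. \<Sum>m\<in>UNIV. gi u m l * \<Gamma> k i m u * T k l u)
        = (\<Sum>l\<in>UNIV. \<Sum>k\<in>UNIV. \<Sum>m\<in>UNIV. gi u m l * \<Gamma> k i m u * T k l u)"
      by (rule sum.swap)
    also have "\<dots> = (\<Sum>l\<in>UNIV. \<Sum>m\<in>UNIV. \<Sum>k\<in>UNIV. gi u m l * \<Gamma> k i m u * T k l u)"
      by (rule sum.cong[OF refl], rule sum.swap)
    also have "\<dots> = (\<Sum>m\<in>UNIV. \<Sum>l\<in>UNIV. \<Sum>k\<in>UNIV. gi u m l * \<Gamma> k i m u * T k l u)"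
      by (rule sum.swap)
    finally show ?thesis by (simp add: mult.assoc)
  qed
  also have "(\<Sum>k\<in>UNIV. \<Sum>l\<in>UNIV. \<Sum>m\<in>UNIV. gi u k m * \<Gamma> l i m u * T k l u)
      = (\<Sum>k\<in>UNIV. \<Sum>l\<in>UNIV. \<Sum>m\<in>UNIV. gi u k l * (\<Gamma> m i l u * T k m u))"
    by (rule sum.cong[OF refl], subst sum.swap) (simp add: mult.assoc)
  finally show ?thesis
    by (simp add: right_diff_distrib sum_subtractf sum_distrib_left)
qed

text \<open>\<open>pd_trace\<close> gives the trace of the covariant derivative of \<open>h\<close>.
  Codazzi then brings the indices into the order in which the trace appears in
  \<open>trace_nabla2_h\<close>.\<close>

lemma pd_H:
  assumes u: "u \<in> W"
  shows "pd j H u = (\<Sum>k\<in>UNIV. \<Sum>l\<in>UNIV. gi u k l * nabla_h l j k u)"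
proof -
  have "pd j H u = (\<Sum>k\<in>UNIV. \<Sum>l\<in>UNIV. gi u k l * (pd j (h k l) u
      - (\<Sum>m\<in>UNIV. \<Gamma> m j k u * h m l u) - (\<Sum>m\<in>UNIV. \<Gamma> m j l u * h k m u)))"
    unfolding mean_curv_def[abs_def] by (rule pd_trace[OF u diff_h[OF u]])
  also have "\<dots> = (\<Sum>k\<in>UNIV. \<Sum>l\<in>UNIV. gi u k l * nabla_h l j k u)"
  proof -
    have "nabla_h j k l u = nabla_h l j k u" for k l
      using codazzi(2)[OF u, of j k l] codazzi(1)[OF u, of j l k] by simp
    then show ?thesis by (simp only: nabla_h_christoffel[OF u])
  qed
  finally show ?thesis .
qed

lemma diff_H: "u \<in> W \<Longrightarrow> H differentiable (at u)"
  unfolding mean_curv_def[abs_def]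
  by (intro differentiable_sum ballI differentiable_mult diff_gi diff_h) simp_all

text \<open>The trace formula for the gradient of \<open>H\<close> involves only
  \<open>nabla_h\<close> and the inverse metric, so it can be differentiated again.\<close>

lemma diff_pd_H:
  assumes u: "u \<in> W"
  shows "pd j H differentiable (at u)"
proof (rule differentiable_cong_open[OF open_W u])
  show "(\<lambda>u. \<Sum>k\<in>UNIV. \<Sum>l\<in>UNIV. gi u k l * nabla_h l j k u) differentiable (at u)"
    by (intro differentiable_sum ballI differentiable_mult diff_gi diff_nabla_h u) simp_all
qed (simp add: pd_H)

text \<open>Tracing commutes with covariant differentiation. \<open>pd_trace\<close> treats
  \<open>j\<close> as a parameter whereas \<open>nabla2_h\<close> also corrects that slot; the
  difference is the Christoffel term that makes the Hessian of \<open>H\<close> covariant.\<close>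

lemma trace_nabla2_h:
  assumes u: "u \<in> W"
  shows "(\<Sum>k\<in>UNIV. \<Sum>l\<in>UNIV. gi u k l * nabla2_h i l j k u) =
    pd i (pd j H) u - (\<Sum>m\<in>UNIV. \<Gamma> m i j u * pd m H u)"
proof -
  have "pd i (pd j H) u = pd i (\<lambda>u. \<Sum>k\<in>UNIV. \<Sum>l\<in>UNIV. gi u k l * nabla_h l j k u) u"
    by (rule pd_cong_open[OF open_W u pd_H diff_pd_H[OF u]])
  also have "\<dots> = (\<Sum>k\<in>UNIV. \<Sum>l\<in>UNIV. gi u k l * (pd i (nabla_h l j k) u
      - (\<Sum>m\<in>UNIV. \<Gamma> m i k u * nabla_h l j m u) - (\<Sum>m\<in>UNIV. \<Gamma> m i l u * nabla_h m j k u)))"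
    by (rule pd_trace[where T = "\<lambda>k l. nabla_h l j k", OF u diff_nabla_h[OF u]])
  also have "\<dots> = (\<Sum>k\<in>UNIV. \<Sum>l\<in>UNIV. gi u k l * (nabla2_h i l j k u
      + (\<Sum>m\<in>UNIV. \<Gamma> m i j u * nabla_h l m k u)))"
    by (simp add: nabla2_h_def algebra_simps)
  also have "\<dots> = (\<Sum>k\<in>UNIV. \<Sum>l\<in>UNIV. gi u k l * nabla2_h i l j k u)
      + (\<Sum>k\<in>UNIV. \<Sum>l\<in>UNIV. \<Sum>m\<in>UNIV. gi u k l * (\<Gamma> m i j u * nabla_h l m k u))"
    by (simp add: distrib_left sum.distrib sum_distrib_left)
  also have "(\<Sum>k\<in>UNIV. \<Sum>l\<in>UNIV. \<Sum>m\<in>UNIV. gi u k l * (\<Gamma> m i j u * nabla_h l m k u))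
      = (\<Sum>m\<in>UNIV. \<Gamma> m i j u * pd m H u)"
  proof -
    have "(\<Sum>k\<in>UNIV. \<Sum>l\<in>UNIV. \<Sum>m\<in>UNIV. gi u k l * (\<Gamma> m i j u * nabla_h l m k u))
        = (\<Sum>k\<in>UNIV. \<Sum>m\<in>UNIV. \<Sum>l\<in>UNIV. gi u k l * (\<Gamma> m i j u * nabla_h l m k u))"
      by (rule sum.cong[OF refl], rule sum.swap)
    also have "\<dots> = (\<Sum>m\<in>UNIV. \<Sum>k\<in>UNIV. \<Sum>l\<in>UNIV. gi u k l * (\<Gamma> m i j u * nabla_h l m k u))"
      by (rule sum.swap)
    finally show ?thesis by (simp add: pd_H u sum_distrib_left mult_ac)
  qed
  finally show ?thesis by simp
qed

text \<open>Exchange \<open>k\<close> and \<open>i\<close> by the Ricci identity and take the trace.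
  The leading term becomes the Hessian of \<open>H\<close>, two of the four cubic terms cancel, and
  the other two give the \<open>H\<close> and \<open>normsq_A\<close> terms.\<close>

theorem simons_identity:
  assumes u: "u \<in> W"
  shows "laplacian f hT [i, j] u =
    pd i (pd j H) u - (\<Sum>m\<in>UNIV. \<Gamma> m i j u * pd m H u)
    + H u * (pd i N u \<bullet> pd j N u) - normsq_A f N u * h i j u"
proof -
  have dual_N: "dual u l \<bullet> pd j N u = - (\<Sum>k\<in>UNIV. gi u k l * h k j u)" for l j
    using gram_inv_sym[OF inv_gram[OF u]]
    by (simp add: weingarten u inner_sum_right inner_dual_dual[OF inv_gram[OF u]] metric_inv_gram
        h_sym[OF u, of j] sum_negf mult.commute)
  \<comment> \<open>Both cancelling terms are rewritten as shape operator pairings of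
    \<open>pd i N u\<close> and \<open>pd j N u\<close>, so that \<open>shape_sym\<close> identifies
    them.\<close>
  have cubic: "(\<Sum>k\<in>UNIV. \<Sum>l\<in>UNIV. gi u k l * (h k j u * (pd l N u \<bullet> pd i N u)))
      = - (\<Sum>l\<in>UNIV. (pd j N u \<bullet> dual u l) * (pd l N u \<bullet> pd i N u))" for i j
    by (subst sum.swap) (simp add: inner_commute[of "pd j N u"] dual_N sum_distrib_right sum_negf mult.assoc)
  have cubic': "(\<Sum>k\<in>UNIV. \<Sum>l\<in>UNIV. gi u k l * (h i l u * (pd j N u \<bullet> pd k N u)))
      = (\<Sum>k\<in>UNIV. \<Sum>l\<in>UNIV. gi u k l * (h k i u * (pd l N u \<bullet> pd j N u)))"
    using gram_inv_sym[OF inv_gram[OF u]]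
    by (subst sum.swap) (simp add: metric_inv_gram h_sym[OF u, of i] inner_commute)
  have "laplacian f hT [i, j] u = (\<Sum>k\<in>UNIV. \<Sum>l\<in>UNIV. gi u k l * nabla2_h k l i j u)"
    unfolding laplacian_def cov_deriv2_h[OF u] ..
  also have "\<dots> = (\<Sum>k\<in>UNIV. \<Sum>l\<in>UNIV. gi u k l * (nabla2_h i l j k u
      + h k l u * (pd i N u \<bullet> pd j N u) + h k j u * (pd l N u \<bullet> pd i N u)
      - h i l u * (pd j N u \<bullet> pd k N u) - h i j u * (pd l N u \<bullet> pd k N u)))"
  proof -
    have "nabla2_h k l i j u = nabla2_h i l j k u
      + h k l u * (pd i N u \<bullet> pd j N u) + h k j u * (pd l N u \<bullet> pd i N u)
      - h i l u * (pd j N u \<bullet> pd k N u) - h i j u * (pd l N u \<bullet> pd k N u)" for k l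
      using nabla2_h_commute[OF u, of k l i j] by simp
    then show ?thesis by (intro sum.cong refl arg_cong2[where f = "(*)"])
  qed
  also have "\<dots> = (\<Sum>k\<in>UNIV. \<Sum>l\<in>UNIV. gi u k l * nabla2_h i l j k u)
      + (\<Sum>k\<in>UNIV. \<Sum>l\<in>UNIV. gi u k l * (h k l u * (pd i N u \<bullet> pd j N u)))
      + (\<Sum>k\<in>UNIV. \<Sum>l\<in>UNIV. gi u k l * (h k j u * (pd l N u \<bullet> pd i N u)))
      - (\<Sum>k\<in>UNIV. \<Sum>l\<in>UNIV. gi u k l * (h i l u * (pd j N u \<bullet> pd k N u)))
      - (\<Sum>k\<in>UNIV. \<Sum>l\<in>UNIV. gi u k l * (h i j u * (pd l N u \<bullet> pd k N u)))"
    by (simp add: distrib_left right_diff_distrib sum.distrib sum_subtractf)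
  also have "(\<Sum>k\<in>UNIV. \<Sum>l\<in>UNIV. gi u k l * (h k j u * (pd l N u \<bullet> pd i N u)))
      = (\<Sum>k\<in>UNIV. \<Sum>l\<in>UNIV. gi u k l * (h i l u * (pd j N u \<bullet> pd k N u)))"
    unfolding cubic' cubic using shape_sym[OF u, of "pd j N u" "pd i N u"] by simp
  also have "(\<Sum>k\<in>UNIV. \<Sum>l\<in>UNIV. gi u k l * (h k l u * (pd i N u \<bullet> pd j N u)))
      = H u * (pd i N u \<bullet> pd j N u)"
    by (simp add: mean_curv_def sum_distrib_right mult.assoc)
  also have "(\<Sum>k\<in>UNIV. \<Sum>l\<in>UNIV. gi u k l * (h i j u * (pd l N u \<bullet> pd k N u)))
      = normsq_A f N u * h i j u"
    by (simp add: normsq_A_eq u sum_distrib_left inner_commute mult_ac)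
  finally show ?thesis by (simp add: trace_nabla2_h u)
qed

end

subsection \<open>Time derivatives along the flow\<close>

lemmas has_vector_derivative_inner = bounded_bilinear.has_vector_derivative[OF bounded_bilinear_inner]
lemmas has_vector_derivative_scaleR_both = bounded_bilinear.has_vector_derivative[OF bounded_bilinear_scaleR]

lemma dt_eqI:
  "at t within I \<noteq> bot \<Longrightarrow> (f has_vector_derivative f') (at t within I) \<Longrightarrow> dt I f t = f'"
  unfolding dt_def by (rule vector_derivative_within)

lemma has_vector_derivative_dt:
  "f differentiable (at t within I) \<Longrightarrow> (f has_vector_derivative dt I f t) (at t within I)"
  unfolding dt_def by (simp add: vector_derivative_works)

lemma has_vector_derivative_eq_on:
  assumes "at t within I \<noteq> bot" "t \<in> I" "\<And>s. s \<in> I \<Longrightarrow> f s = g s"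
    and "(f has_vector_derivative f') (at t within I)" "(g has_vector_derivative g') (at t within I)"
  shows "f' = g'"
  using has_vector_derivative_transform[OF assms(2,3,5)] assms(1,4)
  by (blast intro: vector_derivative_unique_within)

text \<open>The first derivative is hidden by an existential quantifier; it is unique at every point
  of \<open>I\<close>, hence so is the second. This carries the flow equation over to the second
  derivative supplied by \<open>C2_family\<close>.\<close>

lemma has_second_derivative_unique:
  assumes I: "\<And>s. s \<in> I \<Longrightarrow> at s within I \<noteq> bot" and t: "t \<in> I"
    and f: "\<And>s. s \<in> I \<Longrightarrow> (f has_vector_derivative f' s) (at s within I)"
      "(f' has_vector_derivative D) (at t within I)"
    and D': "has_second_derivative I f D' t"
  shows "D' = D"
proof -
  obtain f1 where f1: "\<And>s. s \<in> I \<Longrightarrow> (f has_vector_derivative f1 s) (at s within I)"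
    "(f1 has_vector_derivative D') (at t within I)"
    using D' unfolding has_second_derivative_def by blast
  show ?thesis
    using I[OF t] t _ f1(2) f(2)
    by (rule has_vector_derivative_eq_on)
      (rule vector_derivative_unique_within[OF I f1(1) f(1)])
qed

text \<open>\<open>V\<close> and \<open>Z\<close> are the first two time derivatives of
  \<open>Y\<close>, kept as explicit functions so that their spatial smoothness is at hand.\<close>

locale evolving_patch =
  fixes I :: "real set" and W :: "(real ^ 'n::finite) set"
    and Y V Z N :: "real \<Rightarrow> real ^ 'n \<Rightarrow> 'e::euclidean_space" and c1 :: "real \<Rightarrow> real"
  assumes convex_I: "convex I" and nontrivial: "t \<in> I \<Longrightarrow> at t within I \<noteq> bot"
    and dt_Y: "t \<in> I \<Longrightarrow> u \<in> W \<Longrightarrow> ((\<lambda>s. Y s u) has_vector_derivative V t u) (at t within I)"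
    and dt_V: "t \<in> I \<Longrightarrow> u \<in> W \<Longrightarrow> ((\<lambda>s. V s u) has_vector_derivative Z t u) (at t within I)"
    and smooth_Y: "space_smooth I W Y" and smooth_V: "space_smooth I W V" and smooth_Z: "space_smooth I W Z"
    and patch: "t \<in> I \<Longrightarrow> immersed_patch W (Y t) (N t)"
    and continuous_time_N: "u \<in> W \<Longrightarrow> continuous_on I (\<lambda>s. N s u)"
    and flow: "t \<in> I \<Longrightarrow> u \<in> W \<Longrightarrow> Z t u = mean_curv (Y t) (N t) u *\<^sub>R N t u + c1 t *\<^sub>R Y t u"
begin

lemma open_W: "t \<in> I \<Longrightarrow> open W"
  using patch by (rule immersed_patch.open_W)

lemma dt_pd:
  assumes "t \<in> I" "u \<in> W"
    and "\<And>s w. s \<in> I \<Longrightarrow> w \<in> W \<Longrightarrow> ((\<lambda>s. F s w) has_vector_derivative F' s w) (at s within I)"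
    and "space_smooth I W F" "space_smooth I W F'"
  shows "((\<lambda>s. pd i (F s) u) has_vector_derivative pd i (F' t) u) (at t within I)"
  using convex_I assms(1) open_W[OF assms(1)] assms(2,3)
  by (rule has_vector_derivative_time_pd)
    (blast intro: space_smooth_differentiable space_smooth_continuous space_smooth_pd assms)+

lemma dt_X:
  assumes "t \<in> I" "u \<in> W"
  shows "((\<lambda>s. pd i (Y s) u) has_vector_derivative pd i (V t) u) (at t within I)"
    "((\<lambda>s. pd i (V s) u) has_vector_derivative pd i (Z t) u) (at t within I)"
    "((\<lambda>s. pd i (pd j (Y s)) u) has_vector_derivative pd i (pd j (V t)) u) (at t within I)"
    "((\<lambda>s. pd i (pd j (V s)) u) has_vector_derivative pd i (pd j (Z t)) u) (at t within I)"
  by (rule dt_pd[OF assms]; intro dt_pd dt_Y dt_V space_smooth_pd smooth_Y smooth_V smooth_Z; assumption)+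

lemma pd_Z:
  assumes t: "t \<in> I" and u: "u \<in> W"
  shows "pd k (Z t) u = mean_curv (Y t) (N t) u *\<^sub>R pd k (N t) u + pd k (mean_curv (Y t) (N t)) u *\<^sub>R N t u
    + c1 t *\<^sub>R pd k (Y t) u"
proof -
  interpret P: immersed_patch W "Y t" "N t" using t by (rule patch)
  have "pd k (Z t) u = pd k (\<lambda>u. mean_curv (Y t) (N t) u *\<^sub>R N t u + c1 t *\<^sub>R Y t u) u"
    by (rule pd_cong_open[OF P.open_W u flow[OF t] space_smooth_differentiable[OF smooth_Z t u]])
  then show ?thesis
    by (simp add: pd_add pd_scaleR differentiable_scaleR P.diff_H P.diff_N u
        space_smooth_differentiable[OF smooth_Y t u])
qed

text \<open>Differentiate the flow equation twice in space; \<open>c1\<close> depends on time alone.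
  Against \<open>N\<close> the cross terms vanish since derivatives of \<open>N\<close> are
  tangential, while the second derivative of \<open>N\<close> contributes minus the third
  fundamental form.\<close>

lemma pd_pd_Z_inner_N:
  assumes t: "t \<in> I" and u: "u \<in> W"
  shows "N t u \<bullet> pd i (pd j (Z t)) u = pd i (pd j (mean_curv (Y t) (N t))) u
    - mean_curv (Y t) (N t) u * (pd i (N t) u \<bullet> pd j (N t) u) + c1 t * second_ff (Y t) (N t) i j u"
proof -
  interpret P: immersed_patch W "Y t" "N t" using t by (rule patch)
  have "pd i (pd j (Z t)) u = pd i (\<lambda>u. mean_curv (Y t) (N t) u *\<^sub>R pd j (N t) u
      + pd j (mean_curv (Y t) (N t)) u *\<^sub>R N t u + c1 t *\<^sub>R pd j (Y t) u) u"
    by (rule pd_cong_open[OF P.open_W u pd_Z[OF t]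
          space_smooth_differentiable[OF space_smooth_pd[OF smooth_Z] t u]])
  then show ?thesis
    using P.pd_pd_N_inner_N[OF u, of i j] P.pd_N_inner_N[OF u] P.frame_inner(1)[OF u]
    by (simp add: pd_add pd_scaleR differentiable_add differentiable_scaleR P.diff_H P.diff_pd_H P.diff_N
        P.diff_pd_N P.diff_X u second_ff_def inner_add_right inner_commute)
qed

lemma pd_Z_inner:
  assumes t: "t \<in> I" and u: "u \<in> W"
  shows "N t u \<bullet> pd k (Z t) u = pd k (mean_curv (Y t) (N t)) u"
    "pd i (Z t) u \<bullet> pd j (Y t) u = - mean_curv (Y t) (N t) u * second_ff (Y t) (N t) i j u
      + c1 t * ind_metric (Y t) u $ i $ j"
proof -
  interpret P: immersed_patch W "Y t" "N t" using t by (rule patch)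
  show "N t u \<bullet> pd k (Z t) u = pd k (mean_curv (Y t) (N t)) u"
    "pd i (Z t) u \<bullet> pd j (Y t) u = - mean_curv (Y t) (N t) u * second_ff (Y t) (N t) i j u
      + c1 t * ind_metric (Y t) u $ i $ j"
    using P.frame_inner[OF u] P.pd_N_inner_N[OF u]
    by (simp_all add: pd_Z t u inner_add_left inner_add_right P.pd_N_inner_X ind_metric_def
        inner_commute[of "N t u" "pd _ (N t) u"])
qed

text \<open>Apply the product rule twice. The flow equation gives the two terms containing
  \<open>Z\<close>, which agree because \<open>h\<close> is symmetric.\<close>

theorem metric_evolution:
  assumes t: "t \<in> I" and u: "u \<in> W"
  shows "has_second_derivative I (\<lambda>s. ind_metric (Y s) u $ i $ j)
    (- 2 * mean_curv (Y t) (N t) u * second_ff (Y t) (N t) i j u + 2 * c1 t * ind_metric (Y t) u $ i $ j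
      + 2 * (pd i (V t) u \<bullet> pd j (V t) u)) t"
  unfolding has_second_derivative_def
proof (intro exI conjI ballI)
  show "((\<lambda>s. ind_metric (Y s) u $ i $ j) has_vector_derivative
      pd i (Y s) u \<bullet> pd j (V s) u + pd i (V s) u \<bullet> pd j (Y s) u) (at s within I)" if "s \<in> I" for s
    unfolding ind_metric_def using has_vector_derivative_inner[OF dt_X(1) dt_X(1)] that u by simp
  have "((\<lambda>s. pd i (Y s) u \<bullet> pd j (V s) u + pd i (V s) u \<bullet> pd j (Y s) u) has_vector_derivative
      (pd i (Y t) u \<bullet> pd j (Z t) u + pd i (V t) u \<bullet> pd j (V t) u)
      + (pd i (V t) u \<bullet> pd j (V t) u + pd i (Z t) u \<bullet> pd j (Y t) u)) (at t within I)"
    by (intro has_vector_derivative_add has_vector_derivative_inner dt_X t u)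
  moreover have "pd i (Y t) u \<bullet> pd j (Z t) u = pd i (Z t) u \<bullet> pd j (Y t) u"
    using immersed_patch.h_sym[OF patch[OF t] u, of i j]
    unfolding inner_commute[of "pd i (Y t) u"] pd_Z_inner(2)[OF t u] by (simp add: ind_metric_def inner_commute)
  ultimately show "((\<lambda>s. pd i (Y s) u \<bullet> pd j (V s) u + pd i (V s) u \<bullet> pd j (Y s) u) has_vector_derivative
      - 2 * mean_curv (Y t) (N t) u * second_ff (Y t) (N t) i j u + 2 * c1 t * ind_metric (Y t) u $ i $ j
      + 2 * (pd i (V t) u \<bullet> pd j (V t) u)) (at t within I)"
    by (simp add: pd_Z_inner t u algebra_simps)
qed

section \<open>Time derivatives of the normal\<close>

abbreviation "frame_at u s \<equiv> (\<lambda>i. pd i (Y s) u)"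

lemma normal: "t \<in> I \<Longrightarrow> u \<in> W \<Longrightarrow> normal_frame (frame_at u t) (N t u)"
  using patch by (rule immersed_patch.normal)

lemma time_differentiable_X:
  assumes "t \<in> I" "u \<in> W"
  shows "(\<lambda>s. pd i (Y s) u) differentiable (at t within I)" "(\<lambda>s. pd i (V s) u) differentiable (at t within I)"
    "(\<lambda>s. pd i (pd j (Y s)) u) differentiable (at t within I)"
  using dt_X[OF assms] by (blast intro: differentiableI_vector)+

lemma time_differentiable_dual:
  "t \<in> I \<Longrightarrow> u \<in> W \<Longrightarrow> (\<lambda>s. dual_frame (frame_at u s) k) differentiable (at t within I)"
  by (rule differentiable_dual_frame) (auto intro: time_differentiable_X normal_frame_invertible[OF normal])

lemma time_differentiable_N:
  assumes "t \<in> I" "u \<in> W"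
  shows "(\<lambda>s. N s u) differentiable (at t within I)"
  using _ assms(1) normal[OF _ assms(2)]
  by (rule differentiable_normal)
    (use assms continuous_time_N in \<open>auto intro: time_differentiable_X simp: continuous_on_eq_continuous_within\<close>)

abbreviation "N' u \<equiv> dt I (\<lambda>s. N s u)"

lemma dt_N: "t \<in> I \<Longrightarrow> u \<in> W \<Longrightarrow> ((\<lambda>s. N s u) has_vector_derivative N' u t) (at t within I)"
  by (intro has_vector_derivative_dt time_differentiable_N)

lemma N'_inner:
  assumes t: "t \<in> I" and u: "u \<in> W"
  shows "N' u t \<bullet> pd k (Y t) u = - (N t u \<bullet> pd k (V t) u)" "N' u t \<bullet> N t u = 0"
proof -
  have "N t u \<bullet> pd k (V t) u + N' u t \<bullet> pd k (Y t) u = 0"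
    using nontrivial[OF t] t _ has_vector_derivative_inner[OF dt_N dt_X(1)] has_vector_derivative_const
    by (rule has_vector_derivative_eq_on) (simp_all add: normal_frame_inner(2)[OF normal] t u)
  then show "N' u t \<bullet> pd k (Y t) u = - (N t u \<bullet> pd k (V t) u)" by simp
  have "N t u \<bullet> N' u t + N' u t \<bullet> N t u = 0"
    using nontrivial[OF t] t _ has_vector_derivative_inner[OF dt_N dt_N] has_vector_derivative_const
    by (rule has_vector_derivative_eq_on) (simp_all add: normal_frame_inner(1)[OF normal] t u)
  then show "N' u t \<bullet> N t u = 0" by (simp add: inner_commute)
qed

lemma N'_eq:
  assumes "t \<in> I" "u \<in> W"
  shows "N' u t = (\<Sum>k\<in>UNIV. (- (N t u \<bullet> pd k (V t) u)) *\<^sub>R dual_frame (frame_at u t) k)"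
  using normal_frame_expand_dual[OF normal[OF assms], of "N' u t"] by (simp add: N'_inner assms)

text \<open>As with Weingarten's formula in space, \<open>N'_eq\<close> expresses the derivative
  through undifferentiated \<open>N\<close> and quantities already known to be differentiable in
  time.\<close>

lemma time_differentiable_N':
  assumes t: "t \<in> I" and u: "u \<in> W"
  shows "N' u differentiable (at t within I)"
proof (rule differentiable_transform_within[OF _ zero_less_one t])
  show "(\<lambda>s. \<Sum>k\<in>UNIV. (- (N s u \<bullet> pd k (V s) u)) *\<^sub>R dual_frame (frame_at u s) k) differentiable (at t within I)"
    by (intro differentiable_sum ballI differentiable_scaleR differentiable_minus differentiable_inner
        time_differentiable_N time_differentiable_X time_differentiable_dual t u) simp
qed (simp add: N'_eq u)

abbreviation "N'' u \<equiv> dt I (N' u)"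

lemma dt_N': "t \<in> I \<Longrightarrow> u \<in> W \<Longrightarrow> (N' u has_vector_derivative N'' u t) (at t within I)"
  by (intro has_vector_derivative_dt time_differentiable_N')

text \<open>Differentiate the relations of \<open>N'_inner\<close> once more in time; the flow
  equation turns \<open>N t u \<bullet> pd k (Z t) u\<close> into the gradient of the mean
  curvature.\<close>

lemma N''_inner:
  assumes t: "t \<in> I" and u: "u \<in> W"
  shows "N'' u t \<bullet> pd k (Y t) u = - 2 * (N' u t \<bullet> pd k (V t) u) - pd k (mean_curv (Y t) (N t)) u"
    "N'' u t \<bullet> N t u = - (N' u t \<bullet> N' u t)"
proof -
  have "N' u t \<bullet> pd k (V t) u + N'' u t \<bullet> pd k (Y t) u
      = - (N t u \<bullet> pd k (Z t) u + N' u t \<bullet> pd k (V t) u)"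
    using nontrivial[OF t] t _ has_vector_derivative_inner[OF dt_N' dt_X(1)]
      has_vector_derivative_minus[OF has_vector_derivative_inner[OF dt_N dt_X(2)]]
    by (rule has_vector_derivative_eq_on) (simp_all add: N'_inner t u)
  then show "N'' u t \<bullet> pd k (Y t) u = - 2 * (N' u t \<bullet> pd k (V t) u) - pd k (mean_curv (Y t) (N t)) u"
    by (simp add: pd_Z_inner t u)
  have "N' u t \<bullet> N' u t + N'' u t \<bullet> N t u = 0"
    using nontrivial[OF t] t _ has_vector_derivative_inner[OF dt_N' dt_N] has_vector_derivative_const
    by (rule has_vector_derivative_eq_on) (simp_all add: N'_inner t u)
  then show "N'' u t \<bullet> N t u = - (N' u t \<bullet> N' u t)" by simp
qed

lemma N'_inner_sum:
  assumes t: "t \<in> I" and u: "u \<in> W"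
  shows "N' u t \<bullet> w = - (\<Sum>k\<in>UNIV. \<Sum>l\<in>UNIV. metric_inv (Y t) u $ k $ l * (N t u \<bullet> pd k (V t) u) * (pd l (Y t) u \<bullet> w))"
  by (simp add: N'_eq t u inner_sum_left dual_frame_def metric_inv_gram sum_distrib_left sum_negf mult_ac)

lemma N'_inner_N':
  assumes t: "t \<in> I" and u: "u \<in> W"
  shows "N' u t \<bullet> N' u t =
    (\<Sum>k\<in>UNIV. \<Sum>l\<in>UNIV. metric_inv (Y t) u $ k $ l * (N t u \<bullet> pd k (V t) u) * (N t u \<bullet> pd l (V t) u))"
  by (subst N'_inner_sum[OF t u]) (simp add: inner_commute[of "pd _ (Y t) u"] N'_inner t u sum_negf)

lemma second_derivative_N:
  "t \<in> I \<Longrightarrow> u \<in> W \<Longrightarrow> has_second_derivative I (\<lambda>s. N s u) (N'' u t) t"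
  unfolding has_second_derivative_def using dt_N dt_N' by blast

lemma sum_metric_inv_dual:
  assumes t: "t \<in> I" and u: "u \<in> W"
  shows "(\<Sum>k\<in>UNIV. \<Sum>l\<in>UNIV. (metric_inv (Y t) u $ k $ l * a k) *\<^sub>R pd l (Y t) u)
      = (\<Sum>k\<in>UNIV. a k *\<^sub>R dual_frame (frame_at u t) k)"
    and "(\<Sum>k\<in>UNIV. \<Sum>l\<in>UNIV. (metric_inv (Y t) u $ k $ l * a l) *\<^sub>R pd k (Y t) u)
      = (\<Sum>k\<in>UNIV. a k *\<^sub>R dual_frame (frame_at u t) k)"
proof -
  show 1: "(\<Sum>k\<in>UNIV. \<Sum>l\<in>UNIV. (metric_inv (Y t) u $ k $ l * a k) *\<^sub>R pd l (Y t) u)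
      = (\<Sum>k\<in>UNIV. a k *\<^sub>R dual_frame (frame_at u t) k)"
    by (simp add: dual_frame_def metric_inv_gram scaleR_sum_right mult.commute)
  show "(\<Sum>k\<in>UNIV. \<Sum>l\<in>UNIV. (metric_inv (Y t) u $ k $ l * a l) *\<^sub>R pd k (Y t) u)
      = (\<Sum>k\<in>UNIV. a k *\<^sub>R dual_frame (frame_at u t) k)"
    unfolding 1[symmetric]
    by (subst sum.swap)
      (simp add: metric_inv_gram gram_inv_sym[OF normal_frame_invertible[OF normal[OF t u]], of _ _])
qed

text \<open>The claimed vector and \<open>N'' u t\<close> are compared through their inner products
  with the tangent frame and with the normal.\<close>

theorem normal_evolution:
  assumes t: "t \<in> I" and u: "u \<in> W"
  defines "gi \<equiv> \<lambda>i j. metric_inv (Y t) u $ i $ j" and "X \<equiv> \<lambda>i. pd i (Y t) u"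
    and "X' \<equiv> \<lambda>i. pd i (V t) u"
  shows "has_second_derivative I (\<lambda>s. N s u)
    (- (\<Sum>i\<in>UNIV. \<Sum>j\<in>UNIV. (gi i j * pd i (mean_curv (Y t) (N t)) u) *\<^sub>R X j)
      + (\<Sum>i\<in>UNIV. \<Sum>j\<in>UNIV. (gi i j * (N t u \<bullet> X' i)) *\<^sub>R
          ((\<Sum>k\<in>UNIV. \<Sum>l\<in>UNIV. (2 * gi k l * (X j \<bullet> X' l)) *\<^sub>R X k)
           + (\<Sum>k\<in>UNIV. \<Sum>l\<in>UNIV. (gi k l * (X l \<bullet> X' j)) *\<^sub>R X k) - X' j))) t"
    (is "has_second_derivative I _ ?R t")
proof -
  note F = normal[OF t u]
  let ?d = "dual_frame X"
  have 1: "(\<Sum>i\<in>UNIV. \<Sum>j\<in>UNIV. (gi i j * pd i (mean_curv (Y t) (N t)) u) *\<^sub>R X j)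
      = (\<Sum>i\<in>UNIV. pd i (mean_curv (Y t) (N t)) u *\<^sub>R ?d i)"
    unfolding gi_def X_def by (rule sum_metric_inv_dual(1)[OF t u])
  have 2: "(\<Sum>k\<in>UNIV. \<Sum>l\<in>UNIV. (2 * gi k l * (X j \<bullet> X' l)) *\<^sub>R X k) = (\<Sum>k\<in>UNIV. (2 * (X j \<bullet> X' k)) *\<^sub>R ?d k)" for j
    using sum_metric_inv_dual(2)[OF t u, of "\<lambda>l. 2 * (X j \<bullet> X' l)"]
    unfolding gi_def X_def by (simp add: mult_ac)
  \<comment> \<open>The last two terms of the bracket are the tangential part of \<open>X' j\<close>
    minus \<open>X' j\<close>, hence minus its normal part.\<close>
  have 3: "(\<Sum>k\<in>UNIV. \<Sum>l\<in>UNIV. (gi k l * (X l \<bullet> X' j)) *\<^sub>R X k) - X' j = - ((X' j \<bullet> N t u) *\<^sub>R N t u)" for j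
  proof -
    have "X' j = (\<Sum>k\<in>UNIV. (X k \<bullet> X' j) *\<^sub>R ?d k) + (X' j \<bullet> N t u) *\<^sub>R N t u"
      using normal_frame_expand_dual[OF F, of "X' j"] unfolding X_def inner_commute[of "X' j" "pd _ _ _"] .
    then have "(\<Sum>k\<in>UNIV. (X k \<bullet> X' j) *\<^sub>R ?d k) - X' j = - ((X' j \<bullet> N t u) *\<^sub>R N t u)"
      by (metis add_diff_cancel_left' minus_diff_eq)
    then show ?thesis
      using sum_metric_inv_dual(2)[OF t u, of "\<lambda>l. X l \<bullet> X' j"] unfolding gi_def X_def by simp
  qed
  have R: "?R = - (\<Sum>i\<in>UNIV. pd i (mean_curv (Y t) (N t)) u *\<^sub>R ?d i)
      + (\<Sum>i\<in>UNIV. \<Sum>j\<in>UNIV. (gi i j * (N t u \<bullet> X' i)) *\<^sub>R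
          ((\<Sum>k\<in>UNIV. (2 * (X j \<bullet> X' k)) *\<^sub>R ?d k) - (X' j \<bullet> N t u) *\<^sub>R N t u))"
    unfolding add_diff_eq[symmetric] 1 2 3 by simp
  have d: "?d k \<bullet> X p = (if p = k then 1 else 0)" for k p
    using inner_dual_frame[OF normal_frame_invertible[OF F], of p k] by (simp add: X_def inner_commute)
  have N: "N t u \<bullet> X p = 0" "?d k \<bullet> N t u = 0" "N t u \<bullet> N t u = 1" for p k
    using normal_frame_inner[OF F] by (simp_all add: X_def)
  have "N'' u t = ?R"
  proof (rule normal_frame_eqI[OF F])
    fix p
    have "?R \<bullet> X p = - pd p (mean_curv (Y t) (N t)) u
        + (\<Sum>i\<in>UNIV. \<Sum>j\<in>UNIV. gi i j * (N t u \<bullet> X' i) * (2 * (X j \<bullet> X' p)))"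
      unfolding R by (simp add: inner_add_left inner_diff_left inner_sum_left d N if_distrib cong: if_cong)
    also have "\<dots> = N'' u t \<bullet> pd p (Y t) u"
      unfolding N''_inner[OF t u] N'_inner_sum[OF t u]
      by (simp add: gi_def X_def X'_def sum_distrib_left sum_negf mult_ac)
    finally show "N'' u t \<bullet> pd p (Y t) u = ?R \<bullet> pd p (Y t) u" by (simp add: X_def)
    have "?R \<bullet> N t u = - (\<Sum>i\<in>UNIV. \<Sum>j\<in>UNIV. gi i j * (N t u \<bullet> X' i) * (N t u \<bullet> X' j))"
      unfolding R by (simp add: inner_add_left inner_diff_left inner_sum_left N sum_negf
          inner_commute[of "X' _" "N t u"])
    also have "\<dots> = N'' u t \<bullet> N t u"
      unfolding N''_inner[OF t u] N'_inner_N'[OF t u] by (simp add: gi_def X'_def)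
    finally show "N'' u t \<bullet> N t u = ?R \<bullet> N t u" by simp
  qed
  then show ?thesis using second_derivative_N[OF t u] by simp
qed

section \<open>Evolution of the second fundamental form\<close>

lemma dt_christoffel:
  assumes t: "t \<in> I" and u: "u \<in> W"
  shows "((\<lambda>s. christoffel (Y s) k i j u) has_vector_derivative dt I (\<lambda>s. christoffel (Y s) k i j u) t)
    (at t within I)"
  unfolding christoffel_dual
  by (intro has_vector_derivative_dt differentiable_inner time_differentiable_X time_differentiable_dual t u)

text \<open>Time derivative of the Gauss formula
  \<open>\<partial>\<^sub>i\<partial>\<^sub>j X = \<Gamma>\<^sup>k\<^sub>i\<^sub>j \<partial>\<^sub>k X + h\<^sub>i\<^sub>j N\<close>.\<close>

lemma N'_inner_pd_pd_V:
  assumes t: "t \<in> I" and u: "u \<in> W"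
  shows "N' u t \<bullet> pd i (pd j (V t)) u =
    (\<Sum>k\<in>UNIV. christoffel (Y t) k i j u * (N' u t \<bullet> pd k (V t) u))
    - (\<Sum>k\<in>UNIV. dt I (\<lambda>s. christoffel (Y s) k i j u) t * (N t u \<bullet> pd k (V t) u))
    + second_ff (Y t) (N t) i j u * (N' u t \<bullet> N' u t)"
proof -
  let ?G = "\<lambda>k s. christoffel (Y s) k i j u" and ?h = "\<lambda>s. N s u \<bullet> pd i (pd j (Y s)) u"
  have gauss: "pd i (pd j (Y s)) u = (\<Sum>k\<in>UNIV. ?G k s *\<^sub>R pd k (Y s) u) + ?h s *\<^sub>R N s u" if "s \<in> I" for s
    using normal_frame_expand[OF normal[OF that u], of "pd i (pd j (Y s)) u"]
    by (simp add: christoffel_dual inner_commute)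
  have "((\<lambda>s. (\<Sum>k\<in>UNIV. ?G k s *\<^sub>R pd k (Y s) u) + ?h s *\<^sub>R N s u) has_vector_derivative
      (\<Sum>k\<in>UNIV. ?G k t *\<^sub>R pd k (V t) u + dt I (?G k) t *\<^sub>R pd k (Y t) u)
      + (?h t *\<^sub>R N' u t + (N t u \<bullet> pd i (pd j (V t)) u + N' u t \<bullet> pd i (pd j (Y t)) u) *\<^sub>R N t u))
      (at t within I)"
    by (intro has_vector_derivative_add has_vector_derivative_sum has_vector_derivative_scaleR_both
        has_vector_derivative_inner dt_christoffel dt_X dt_N t u)
  from has_vector_derivative_eq_on[OF nontrivial[OF t] t gauss dt_X(3)[OF t u] this]
  \<comment> \<open>Pairing with \<open>N' u t\<close> removes the multiple of \<open>N t u\<close>,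
    and \<open>N'_inner\<close> turns the tangent vectors next to the differentiated Christoffel
    symbols into the term with a minus sign.\<close>
  have "N' u t \<bullet> pd i (pd j (V t)) u = N' u t \<bullet>
      ((\<Sum>k\<in>UNIV. ?G k t *\<^sub>R pd k (V t) u + dt I (?G k) t *\<^sub>R pd k (Y t) u)
      + (?h t *\<^sub>R N' u t + (N t u \<bullet> pd i (pd j (V t)) u + N' u t \<bullet> pd i (pd j (Y t)) u) *\<^sub>R N t u))"
    by (rule arg_cong)
  then show ?thesis
    by (simp add: inner_add_right inner_sum_right N'_inner t u second_ff_def sum.distrib sum_negf)
qed

text \<open>The second derivative consists of the \<open>Z\<close> term, twice \<open>N'\<close>
  against the second derivatives of \<open>V\<close>, and \<open>N''\<close> against those of
  \<open>Y\<close>. The sums of Christoffel symbols with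
  \<open>N' u t \<bullet> pd k (V t) u\<close> cancel between the last two, and one copy of
  \<open>h i j * (N' u t \<bullet> N' u t)\<close> remains. The gradient of \<open>H\<close> in
  \<open>N''\<close> completes the Hessian; Simons' identity adds a second \<open>H\<close> term to
  the one from \<open>Z\<close>, hence the factor 2.\<close>

theorem second_ff_evolution:
  assumes t: "t \<in> I" and u: "u \<in> W"
  defines "h \<equiv> \<lambda>i j. second_ff (Y t) (N t) i j u" and "gi \<equiv> \<lambda>i j. metric_inv (Y t) u $ i $ j"
    and "X' \<equiv> \<lambda>i. pd i (V t) u"
  shows "has_second_derivative I (\<lambda>s. second_ff (Y s) (N s) i j u)
    (laplacian (Y t) (\<lambda>is. second_ff (Y t) (N t) (is ! 0) (is ! 1)) [i, j] u
      - 2 * mean_curv (Y t) (N t) u * (\<Sum>l\<in>UNIV. \<Sum>m\<in>UNIV. h i l * h m j * gi l m)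
      + normsq_A (Y t) (N t) u * h i j
      + (\<Sum>k\<in>UNIV. \<Sum>l\<in>UNIV. gi k l * h i j * (N t u \<bullet> X' k) * (N t u \<bullet> X' l))
      - 2 * (\<Sum>k\<in>UNIV. dt I (\<lambda>s. christoffel (Y s) k i j u) t * (N t u \<bullet> X' k))
      + c1 t * h i j) t"
    (is "has_second_derivative I _ ?R t")
  unfolding has_second_derivative_def
proof (intro exI conjI ballI)
  show "((\<lambda>s. second_ff (Y s) (N s) i j u) has_vector_derivative
      N s u \<bullet> pd i (pd j (V s)) u + N' u s \<bullet> pd i (pd j (Y s)) u) (at s within I)" if "s \<in> I" for s
    unfolding second_ff_def by (intro has_vector_derivative_inner dt_X dt_N that u)
  have "((\<lambda>s. N s u \<bullet> pd i (pd j (V s)) u + N' u s \<bullet> pd i (pd j (Y s)) u) has_vector_derivative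
      (N t u \<bullet> pd i (pd j (Z t)) u + N' u t \<bullet> pd i (pd j (V t)) u)
      + (N' u t \<bullet> pd i (pd j (V t)) u + N'' u t \<bullet> pd i (pd j (Y t)) u)) (at t within I)"
    by (intro has_vector_derivative_add has_vector_derivative_inner dt_X dt_N dt_N' t u)
  moreover have "(N t u \<bullet> pd i (pd j (Z t)) u + N' u t \<bullet> pd i (pd j (V t)) u)
      + (N' u t \<bullet> pd i (pd j (V t)) u + N'' u t \<bullet> pd i (pd j (Y t)) u) = ?R"
  proof -
    interpret P: immersed_patch W "Y t" "N t" using t by (rule patch)
    have "N'' u t \<bullet> pd i (pd j (Y t)) u =
        (\<Sum>k\<in>UNIV. christoffel (Y t) k i j u * (- 2 * (N' u t \<bullet> pd k (V t) u) - pd k (mean_curv (Y t) (N t)) u))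
        - h i j * (N' u t \<bullet> N' u t)"
      using normal_frame_inner_expand[OF normal[OF t u], of "pd i (pd j (Y t)) u" "N'' u t"]
        N''_inner[OF t u]
      by (simp add: christoffel_dual h_def second_ff_def inner_commute)
    then have *: "N'' u t \<bullet> pd i (pd j (Y t)) u =
        - 2 * (\<Sum>k\<in>UNIV. christoffel (Y t) k i j u * (N' u t \<bullet> pd k (V t) u))
        - (\<Sum>k\<in>UNIV. christoffel (Y t) k i j u * pd k (mean_curv (Y t) (N t)) u)
        - h i j * (N' u t \<bullet> N' u t)"
      by (simp add: right_diff_distrib sum_subtractf sum_distrib_left mult_ac)
    have gg: "h i j * (N' u t \<bullet> N' u t)
        = (\<Sum>k\<in>UNIV. \<Sum>l\<in>UNIV. gi k l * h i j * (N t u \<bullet> X' k) * (N t u \<bullet> X' l))"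
      unfolding N'_inner_N'[OF t u] by (simp add: gi_def X'_def sum_distrib_left mult_ac)
    show ?thesis
      using P.simons_identity[OF u, of i j] P.pd_N_inner_pd_N[OF u, of i j]
      unfolding * gg[symmetric] pd_pd_Z_inner_N[OF t u] N'_inner_pd_pd_V[OF t u]
      by (simp add: h_def gi_def X'_def algebra_simps)
  qed
  ultimately show "((\<lambda>s. N s u \<bullet> pd i (pd j (V s)) u + N' u s \<bullet> pd i (pd j (Y s)) u)
      has_vector_derivative ?R) (at t within I)" by simp
qed

end

section \<open>From the manifold to a coordinate patch\<close>

lemma immersion_independent:
  fixes f :: "real ^ 'n::finite \<Rightarrow> 'e::real_normed_vector"
  assumes f: "f differentiable (at u)" and inj: "inj (frechet_derivative f (at u))"
    and c: "(\<Sum>i\<in>UNIV. c i *\<^sub>R pd i f u) = 0"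
  shows "c i = 0"
proof -
  let ?D = "frechet_derivative f (at u)" and ?c = "\<chi> i. c i"
  have lin: "linear ?D" using f by (rule linear_frechet_derivative)
  have "?c = (\<Sum>i\<in>UNIV. c i *\<^sub>R axis i 1)"
    using basis_expansion[of ?c] by (simp add: scalar_mult_eq_scaleR)
  then have "?D ?c = (\<Sum>i\<in>UNIV. c i *\<^sub>R pd i f u)"
    using lin by (simp add: linear_sum linear_cmul pd_def)
  then have "?c = 0"
    using c inj linear_injective_0[OF lin] by simp
  then show ?thesis by (simp add: vec_eq_iff)
qed

text \<open>A connected set that is not a singleton has no isolated points, so derivatives within
  \<open>I\<close> are unique, also at endpoints.\<close>

lemma interval_nontrivial:
  fixes I :: "real set"
  assumes "is_interval I" "interior I \<noteq> {}" "t \<in> I"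
  shows "at t within I \<noteq> bot"
proof -
  have "I \<noteq> {y}" for y using assms(2) by auto
  then have "t islimpt I"
    using assms by (intro connected_imp_perfect) (simp_all add: is_interval_connected)
  then show ?thesis by (simp add: trivial_limit_within)
qed

text \<open>\<open>loc\<close> is built on \<open>inv_into\<close>, a choice function. Injectivity
  of the chart identifies it on the image with the continuous inverse \<open>g\<close>, through
  which continuity of the normal is pulled back.\<close>

lemma smooth_atlas_chart:
  assumes "smooth_atlas M A" "(U, \<phi>) \<in> A"
  obtains g where "open (\<phi> ` U)" "U \<subseteq> topspace M"
    "\<And>x. x \<in> U \<Longrightarrow> inv_into U \<phi> (\<phi> x) = x"
    "continuous_map (top_of_set (\<phi> ` U)) M g" "\<And>w. w \<in> \<phi> ` U \<Longrightarrow> inv_into U \<phi> w = g w"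
proof -
  have c: "openin M U" "open (\<phi> ` U)" "homeomorphic_map (subtopology M U) (top_of_set (\<phi> ` U)) \<phi>"
    using assms unfolding smooth_atlas_def by auto
  then have U: "U \<subseteq> topspace M" by (simp add: openin_subset)
  then have top: "topspace (subtopology M U) = U" by auto
  obtain g where g: "homeomorphic_maps (subtopology M U) (top_of_set (\<phi> ` U)) \<phi> g"
    using c(3) unfolding homeomorphic_map_maps by blast
  then have gx: "g (\<phi> x) = x" if "x \<in> U" for x
    using that unfolding homeomorphic_maps_def top by blast
  then have inj: "inj_on \<phi> U" by (rule inj_on_inverseI)
  have "continuous_map (top_of_set (\<phi> ` U)) M g"
    using g unfolding homeomorphic_maps_def by (blast intro: continuous_map_into_fulltopology)
  moreover have "inv_into U \<phi> (\<phi> x) = x" if "x \<in> U" for x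
    using inj that by (rule inv_into_f_f)
  moreover have "inv_into U \<phi> w = g w" if "w \<in> \<phi> ` U" for w
    using that inj gx by auto
  ultimately show thesis using c(2) U by (intro that[of g])
qed

theorem theorem7p2:
  fixes M :: "'a topology"
    and A :: "('a, 'n::finite) chart set"
    and I :: "real set"
    and X \<nu> :: "real \<Rightarrow> 'a \<Rightarrow> real ^ 'm::finite"
    and c1 :: "real \<Rightarrow> real"
    and U :: "'a set" and \<phi> :: "'a \<Rightarrow> real ^ 'n"
    and Y N :: "real \<Rightarrow> real ^ 'n \<Rightarrow> real ^ 'm"
    and t :: real and x :: 'a and u :: "real ^ 'n"
  assumes codim: "CARD('m) = CARD('n) + 1"
    and M: "smooth_manifold M A"
    and I: "is_interval I" "interior I \<noteq> {}"
    and X: "\<And>t. t \<in> I \<Longrightarrow> smooth_immersion A (X t)" "C2_family A I X"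
    and \<nu>: "unit_normal_field M A I X \<nu>"
    and c1: "continuous_on I c1" "bounded (c1 ` I)"
    and flow: "hyperbolic_mcf A I c1 X \<nu>"
    and chart: "(U, \<phi>) \<in> A"
    and Y: "Y = (\<lambda>s. loc (U, \<phi>) (X s))"
    and N: "N = (\<lambda>s. loc (U, \<phi>) (\<nu> s))"
    and t: "t \<in> I" and x: "x \<in> U" and u: "u = \<phi> x"
  shows
    "let g = (\<lambda>i j. ind_metric (Y t) u $ i $ j);
         gi = (\<lambda>i j. metric_inv (Y t) u $ i $ j);
         h = (\<lambda>i j. second_ff (Y t) (N t) i j u);
         H = mean_curv (Y t) (N t) u;
         dH = (\<lambda>i. pd i (mean_curv (Y t) (N t)) u);
         A2 = normsq_A (Y t) (N t) u;
         n = \<nu> t x;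
         dX = (\<lambda>i. pd i (Y t) u);
         dtX = (\<lambda>i. dt I (\<lambda>s. pd i (Y s) u) t);
         dt\<Gamma> = (\<lambda>k i j. dt I (\<lambda>s. christoffel (Y s) k i j u) t);
         \<Delta>h = (\<lambda>i j. laplacian (Y t) (\<lambda>is. second_ff (Y t) (N t) (is ! 0) (is ! 1)) [i, j] u)
     in
       (\<forall>i j. has_second_derivative I (\<lambda>s. ind_metric (Y s) u $ i $ j)
          (- 2 * H * h i j + 2 * c1 t * g i j + 2 * (dtX i \<bullet> dtX j)) t)
     \<and> has_second_derivative I (\<lambda>s. \<nu> s x)
          (- (\<Sum>i\<in>UNIV. \<Sum>j\<in>UNIV. (gi i j * dH i) *\<^sub>R dX j)
           + (\<Sum>i\<in>UNIV. \<Sum>j\<in>UNIV. (gi i j * (n \<bullet> dtX i)) *\<^sub>R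
                ((\<Sum>k\<in>UNIV. \<Sum>l\<in>UNIV. (2 * gi k l * (dX j \<bullet> dtX l)) *\<^sub>R dX k)
                 + (\<Sum>k\<in>UNIV. \<Sum>l\<in>UNIV. (gi k l * (dX l \<bullet> dtX j)) *\<^sub>R dX k)
                 - dtX j))) t
     \<and> (\<forall>i j. has_second_derivative I (\<lambda>s. second_ff (Y s) (N s) i j u)
          (\<Delta>h i j
           - 2 * H * (\<Sum>l\<in>UNIV. \<Sum>m\<in>UNIV. h i l * h m j * gi l m)
           + A2 * h i j
           + (\<Sum>k\<in>UNIV. \<Sum>l\<in>UNIV. gi k l * h i j * (n \<bullet> dtX k) * (n \<bullet> dtX l))
           - 2 * (\<Sum>k\<in>UNIV. dt\<Gamma> k i j * (n \<bullet> dtX k))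
           + c1 t * h i j) t)"
proof -
  define W where "W = \<phi> ` U"
  have atlas: "smooth_atlas M A" using M by (simp add: smooth_manifold_def)
  obtain g where W: "open W" and U: "U \<subseteq> topspace M"
    and inv: "\<And>x. x \<in> U \<Longrightarrow> inv_into U \<phi> (\<phi> x) = x"
    and g: "continuous_map (top_of_set W) M g" "\<And>w. w \<in> W \<Longrightarrow> inv_into U \<phi> w = g w"
    using smooth_atlas_chart[OF atlas chart] unfolding W_def by metis
  have uW: "u \<in> W" using x u by (simp add: W_def)
  have Y_at: "Y s (\<phi> y) = X s y" and N_at: "N s (\<phi> y) = \<nu> s y" if "y \<in> U" for s y
    using inv[OF that] by (simp_all add: Y N loc_def)
  have nontrivial: "at s within I \<noteq> bot" if "s \<in> I" for s
    using I that by (rule interval_nontrivial)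
  obtain V Z where V: "\<And>s w. s \<in> I \<Longrightarrow> w \<in> W \<Longrightarrow> ((\<lambda>s. Y s w) has_vector_derivative V s w) (at s within I)"
    and Z: "\<And>s w. s \<in> I \<Longrightarrow> w \<in> W \<Longrightarrow> ((\<lambda>s. V s w) has_vector_derivative Z s w) (at s within I)"
    and smooth: "space_smooth I W Y" "space_smooth I W V" "space_smooth I W Z"
  proof -
    have "C2_family_on I W Y"
      using X(2) chart unfolding C2_family_def W_def Y by fast
    then show thesis using that unfolding C2_family_on_def by blast
  qed
  have \<nu>_cont: "continuous_map (prod_topology (top_of_set I) M) euclidean (\<lambda>(t, x). \<nu> t x)"
    and \<nu>_norm: "\<And>s y. s \<in> I \<Longrightarrow> y \<in> topspace M \<Longrightarrow> norm (\<nu> s y) = 1"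
    and \<nu>_orth: "\<And>s y i. s \<in> I \<Longrightarrow> y \<in> U \<Longrightarrow> \<nu> s y \<bullet> pd i (Y s) (\<phi> y) = 0"
    using \<nu> chart unfolding unit_normal_field_def Y by auto
  interpret evolving_patch I W Y V Z N c1
  proof (rule evolving_patch.intro)
    show "convex I" using I(1) by (simp add: is_interval_convex)
    show "immersed_patch W (Y s) (N s)" if s: "s \<in> I" for s
    proof (rule immersed_patch.intro)
      have imm: "smooth_on W (Y s)" "\<And>w. w \<in> W \<Longrightarrow> inj (frechet_derivative (Y s) (at w))"
        using X(1)[OF s] chart unfolding smooth_immersion_def Y W_def by auto
      show "open W" "smooth_on W (Y s)" by fact+
      show "normal_frame (\<lambda>i. pd i (Y s) w) (N s w)" if w: "w \<in> W" for w
      proof -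
        obtain y where y: "y \<in> U" "w = \<phi> y" using w by (auto simp: W_def)
        have "c i = 0" if "(\<Sum>i\<in>UNIV. c i *\<^sub>R pd i (Y s) w) = 0" for c i
          using smooth_on_differentiable[OF imm(1) w] imm(2)[OF w] that by (rule immersion_independent)
        then show ?thesis
          using y U s codim by (auto simp: normal_frame_def N_at \<nu>_norm \<nu>_orth)
      qed
      \<comment> \<open>Joint continuity of the normal on space-time is restricted to the slice at
        time \<open>s\<close>, entered through the inverse chart; below it is restricted to the time
        line through a fixed point.\<close>
      have "continuous_map (top_of_set W) (prod_topology (top_of_set I) M) (\<lambda>w. (s, g w))"
        using s g(1) by (intro continuous_map_pairedI) simp_all
      from continuous_map_compose[OF this \<nu>_cont]
      have "continuous_on W (\<lambda>w. \<nu> s (g w))" by (simp add: o_def)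
      then show "continuous_on W (N s)"
        by (rule continuous_on_eq) (simp add: N loc_def g(2))
    qed
    show "continuous_on I (\<lambda>s. N s w)" if w: "w \<in> W" for w
    proof -
      obtain y where y: "y \<in> U" "w = \<phi> y" using w by (auto simp: W_def)
      have "continuous_map (top_of_set I) (prod_topology (top_of_set I) M) (\<lambda>s. (s, y))"
        using y U by (intro continuous_map_pairedI) auto
      from continuous_map_compose[OF this \<nu>_cont]
      show ?thesis by (simp add: o_def N_at y)
    qed
    show "Z s w = mean_curv (Y s) (N s) w *\<^sub>R N s w + c1 s *\<^sub>R Y s w" if s: "s \<in> I" and w: "w \<in> W" for s w
    proof -
      obtain y where y: "y \<in> U" "w = \<phi> y" using w by (auto simp: W_def)
      \<comment> \<open>The flow equation only states a second derivative; uniqueness identifies it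
        with \<open>Z\<close>, which is differentiable in space.\<close>
      have "has_second_derivative I (\<lambda>s. Y s w) (mean_curv (Y s) (N s) w *\<^sub>R N s w + c1 s *\<^sub>R Y s w) s"
        using flow chart s y(1) unfolding hyperbolic_mcf_def y(2) Y_at[OF y(1)] N_at[OF y(1)]
        unfolding Y N by fast
      from has_second_derivative_unique[OF nontrivial s V[OF _ w] Z[OF s w] this]
      show ?thesis by simp
    qed
  qed (fact nontrivial V Z smooth)+
  have dtX: "dt I (\<lambda>s. pd i (Y s) u) t = pd i (V t) u" for i
    by (rule dt_eqI[OF nontrivial[OF t] dt_X(1)[OF t uW]])
  have \<nu>x: "(\<lambda>s. \<nu> s x) = (\<lambda>s. N s u)" "\<nu> t x = N t u"
    using N_at[OF x] u by simp_all
  show ?thesis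
    unfolding Let_def dtX \<nu>x
    using metric_evolution[OF t uW] normal_evolution[OF t uW] second_ff_evolution[OF t uW] by blast
qed

end
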